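(* Under Assumption 1 (stated in the context), the mixed cost $J_{\mathrm{mix}}$ is real analytic on $\mathcal{K}_\beta$.
   Context: Let $A\in\mathbb{R}^{n\times n}$, $B\in\mathbb{R}^{n\times m}$, $B_w\in\mathbb{R}^{n\times n}$, $W:=B_wB_w^{\mathsf T}$. Let $Q_2\succeq0$, $R_2\succ0$, $Q_\infty\succ0$, $R_\infty\succ0$ be symmetric weight matrices and $\beta>0$. For $K\in\mathbb{R}^{m\times n}$ write $A_K:=A+BK$, $S_K:=Q_\infty+K^{\mathsf T}R_\infty K$. Let $\mathcal{K}:=\{K: A_K \text{ Hurwitz}\}$. For $K\in\mathcal{K}$ let $\mathbf{T}_\infty(K)(s)=\begin{bmatrix}Q_\infty^{1/2}\\ R_\infty^{1/2}K\end{bmatrix}(sI-A_K)^{-1}B_w$ and $\mathcal{K}_\beta:=\{K\in\mathcal{K}:\|\mathbf{T}_\infty(K)\|_{\mathcal{H}_\infty}<\beta\}$. For $K\in\mathcal{K}_\beta$ the Riccati equation $A_KX+XA_K^{\mathsf T}+\beta^{-2}XS_KX+W=0$ has a unique stabilizing solution $X_K\succeq0$ (i.e. $A_K+\beta^{-2}X_KS_K$ Hurwitz), and $J_{\mathrm{mix}}(K):=\operatorname{tr}((Q_2+K^{\mathsf T}R_2K)X_K)$. Assumption 1: $(A,B)$ stabilizable, $(Q_2^{1/2},A)$ detectable, and $\beta>\inf_{K\in\mathcal{K}}\|\mathbf{T}_\infty(K)\|_{\mathcal{H}_\infty}$. *)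

theory Defs
  imports "HOL-Analysis.Analysis"
begin

definition cmat :: "real^'c^'r \<Rightarrow> complex^'c^'r" where
  "cmat M = (\<chi> i j. complex_of_real (M $ i $ j))"

definition symmetric_mat :: "real^'n^'n \<Rightarrow> bool" where
  "symmetric_mat M \<longleftrightarrow> transpose M = M"

definition psd :: "real^'n^'n \<Rightarrow> bool" where
  "psd M \<longleftrightarrow> symmetric_mat M \<and> (\<forall>x. 0 \<le> x \<bullet> (M *v x))"

definition pd :: "real^'n^'n \<Rightarrow> bool" where
  "pd M \<longleftrightarrow> symmetric_mat M \<and> (\<forall>x. x \<noteq> 0 \<longrightarrow> 0 < x \<bullet> (M *v x))"

definition psd_sqrt :: "real^'n^'n \<Rightarrow> real^'n^'n" where
  "psd_sqrt M = (THE P. psd P \<and> P ** P = M)"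

definition hurwitz :: "real^'n^'n \<Rightarrow> bool" where
  "hurwitz M \<longleftrightarrow>
     (\<forall>(l::complex) (v::complex^'n). v \<noteq> 0 \<and> cmat M *v v = l *s v \<longrightarrow> Re l < 0)"

text \<open>Value of the transfer matrix
  \<open>T_\<infinity>(K)(i\<omega>) = [Q^{1/2}; R^{1/2} K] (i\<omega> I - A_K)^{-1} B_w\<close>
  applied to an input \<open>w\<close>; the stacked output is the pair of its two blocks
  (the norm on pairs is the Euclidean norm of the stacked vector).\<close>
definition T_inf ::
  "real^'n^'n \<Rightarrow> real^'m^'m \<Rightarrow> real^'n^'n \<Rightarrow> real^'m^'n \<Rightarrow> real^'n^'n \<Rightarrow> real^'n^'m
     \<Rightarrow> real \<Rightarrow> complex^'n \<Rightarrow> (complex^'n) \<times> (complex^'m)" where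
  "T_inf Qi Ri A B Bw K \<omega> w =
     (let x = matrix_inv (mat (\<i> * complex_of_real \<omega>) - cmat (A + B ** K)) *v (cmat Bw *v w)
      in (cmat (psd_sqrt Qi) *v x, cmat (psd_sqrt Ri ** K) *v x))"

definition hinf_norm ::
  "real^'n^'n \<Rightarrow> real^'m^'m \<Rightarrow> real^'n^'n \<Rightarrow> real^'m^'n \<Rightarrow> real^'n^'n \<Rightarrow> real^'n^'m \<Rightarrow> real" where
  "hinf_norm Qi Ri A B Bw K = (SUP \<omega>::real. onorm (T_inf Qi Ri A B Bw K \<omega>))"

definition Kbeta ::
  "real^'n^'n \<Rightarrow> real^'m^'m \<Rightarrow> real^'n^'n \<Rightarrow> real^'m^'n \<Rightarrow> real^'n^'n \<Rightarrow> real \<Rightarrow> (real^'n^'m) set" where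
  "Kbeta Qi Ri A B Bw \<beta> = {K. hurwitz (A + B ** K) \<and> hinf_norm Qi Ri A B Bw K < \<beta>}"

definition S_mat :: "real^'n^'n \<Rightarrow> real^'m^'m \<Rightarrow> real^'n^'m \<Rightarrow> real^'n^'n" where
  "S_mat Qi Ri K = Qi + transpose K ** Ri ** K"

definition X_sol ::
  "real^'n^'n \<Rightarrow> real^'m^'m \<Rightarrow> real^'n^'n \<Rightarrow> real^'m^'n \<Rightarrow> real^'n^'n \<Rightarrow> real \<Rightarrow> real^'n^'m \<Rightarrow> real^'n^'n" where
  "X_sol Qi Ri A B Bw \<beta> K =
     (THE X. symmetric_mat X \<and>
        (A + B ** K) ** X + X ** transpose (A + B ** K)
          + (inverse (\<beta>^2)) *\<^sub>R (X ** S_mat Qi Ri K ** X) + Bw ** transpose Bw = 0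
        \<and> hurwitz ((A + B ** K) + (inverse (\<beta>^2)) *\<^sub>R (X ** S_mat Qi Ri K)))"

definition J_mix ::
  "real^'n^'n \<Rightarrow> real^'m^'m \<Rightarrow> real^'n^'n \<Rightarrow> real^'m^'m \<Rightarrow> real^'n^'n \<Rightarrow> real^'m^'n
     \<Rightarrow> real^'n^'n \<Rightarrow> real \<Rightarrow> real^'n^'m \<Rightarrow> real" where
  "J_mix Q2 R2 Qi Ri A B Bw \<beta> K =
     trace ((Q2 + transpose K ** R2 ** K) ** X_sol Qi Ri A B Bw \<beta> K)"

definition real_analytic_on_mat :: "(real^'c^'r \<Rightarrow> real) \<Rightarrow> (real^'c^'r) set \<Rightarrow> bool" where
  "real_analytic_on_mat f S \<longleftrightarrow>
     (\<forall>K0\<in>S. \<exists>r>0. ball K0 r \<subseteq> S \<and>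
        (\<exists>c :: ('r \<Rightarrow> 'c \<Rightarrow> nat) \<Rightarrow> real.
           \<forall>K\<in>ball K0 r.
             ((\<lambda>\<alpha>. c \<alpha> * (\<Prod>i\<in>UNIV. \<Prod>j\<in>UNIV. (K $ i $ j - K0 $ i $ j) ^ (\<alpha> i j)))
                has_sum f K) UNIV))"

end

theory Submission
  imports Defs "HOL-Complex_Analysis.Complex_Analysis"
    "HOL-Computational_Algebra.Fundamental_Theorem_Algebra"
begin

text \<open>
  Call \<open>K\<close> solvable if the Riccati equation at \<open>K\<close> has a stabilizing solution.
  Near a solvable \<open>K\<^sub>0\<close> the linearization \<open>Y \<mapsto> F Y + Y F\<^sup>T\<close> of the Riccati operator is
  invertible, because \<open>F\<close> is Hurwitz, and the quadratic equation for the increment of the solution is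
  solved by a contraction in an algebra of absolutely convergent power series in the entries of
  \<open>K - K\<^sub>0\<close>; the result is stabilizing, hence equal to \<open>X\<^sub>K\<close> by uniqueness.

  The solvable gains are also closed in the constraint set: since \<open>S\<^sub>K \<succeq> Q\<^sub>\<infinity> \<succ> 0\<close>, the quadratic term
  bounds the solutions, and an imaginary eigenvalue of the closed loop in the limit would produce an
  input that the transfer matrix amplifies by the factor \<open>\<beta>\<close>. Hence near an unsolvable \<open>K\<^sub>0\<close> the
  description defining \<open>X\<^sub>K\<close> is constantly undefined and the cost is a polynomial in \<open>K\<close>. This makes
  the proof independent of the existence of the stabilizing solution, i.e. of the bounded real lemma.
\<close>

section \<open>Absolutely convergent power series in the entries of a matrix\<close>

text \<open>The algebra is a weighted l1 space of coefficient families. On a box of radius r a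
  monomial of degree k is at most r^k, so its norm dominates the sup norm; it is also
  submultiplicative and complete, so the iteration delivers the coefficients of the solution without
  any derivatives. The radius must be chosen last: bounds are kept uniform in r <= 1, and data
  vanishing at \<open>K0\<close> gain a factor r, which makes the map a contraction. Invertibility
  of the linearization, uniqueness of the stabilizing solution and uniqueness of the positive square
  root all rest on one fact: F D + D G^T = 0 forces D = 0 when F and G are Hurwitz. The obstacle in
  the limit argument is that the Hurwitz property is not closed. Hurwitz's theorem on zeros leaves
  Re l <= 0, and only the strict gain bound excludes the imaginary axis. That bound is stated
  through square roots given by \<open>THE\<close> and through a \<open>SUP\<close> of reals, so the
  roots have to be constructed and the supremum shown to be bounded before the constraint can be
  used.\<close>

definition mdeg :: "('r::finite \<Rightarrow> 'c::finite \<Rightarrow> nat) \<Rightarrow> nat" where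
  "mdeg \<alpha> = (\<Sum>i\<in>UNIV. \<Sum>j\<in>UNIV. \<alpha> i j)"

definition mon :: "real^'c^'r \<Rightarrow> ('r \<Rightarrow> 'c \<Rightarrow> nat) \<Rightarrow> real" where
  "mon H \<alpha> = (\<Prod>i\<in>UNIV. \<Prod>j\<in>UNIV. (H $ i $ j) ^ \<alpha> i j)"

definition mbox :: "real \<Rightarrow> (real^'c^'r) set" where
  "mbox r = {H. \<forall>i j. \<bar>H $ i $ j\<bar> \<le> r}"

text \<open>C bounds the weighted l1 norm of some coefficient family of f. A predicate that carries
  the bound and hides the coefficients gives the estimates of a Banach algebra without building its
  type. Expansions are about 0, so the arguments are increments H = K - K0.\<close>

definition ana :: "real \<Rightarrow> real \<Rightarrow> (real^'c^'r \<Rightarrow> 'a::banach) \<Rightarrow> bool" where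
  "ana r C f \<longleftrightarrow> (\<exists>c. \<exists>s\<le>C. ((\<lambda>\<alpha>. norm (c \<alpha>) * r ^ mdeg \<alpha>) has_sum s) UNIV \<and>
      (\<forall>H\<in>mbox r. ((\<lambda>\<alpha>. mon H \<alpha> *\<^sub>R c \<alpha>) has_sum f H) UNIV))"

lemma mon_add: "mon H (\<lambda>i j. \<alpha> i j + \<gamma> i j) = mon H \<alpha> * mon H \<gamma>"
  by (simp add: mon_def power_add prod.distrib)

lemma mdeg_add: "mdeg (\<lambda>i j. \<alpha> i j + \<gamma> i j) = mdeg \<alpha> + mdeg \<gamma>"
  by (simp add: mdeg_def sum.distrib)

lemma abs_mon_le:
  assumes "H \<in> mbox r"
  shows "\<bar>mon H \<alpha>\<bar> \<le> r ^ mdeg \<alpha>"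
proof -
  have "\<bar>mon H \<alpha>\<bar> = (\<Prod>i\<in>UNIV. \<Prod>j\<in>UNIV. \<bar>H $ i $ j\<bar> ^ \<alpha> i j)"
    by (simp add: mon_def abs_prod power_abs)
  also have "\<dots> \<le> (\<Prod>i\<in>UNIV. \<Prod>j\<in>UNIV. r ^ \<alpha> i j)"
    using assms by (intro prod_mono conjI power_mono prod_nonneg) (auto simp: mbox_def)
  also have "\<dots> = r ^ mdeg \<alpha>"
    by (simp add: mdeg_def power_sum)
  finally show ?thesis .
qed

lemma dominated_has_sum:
  fixes f g :: "'p \<Rightarrow> real"
  assumes g: "(g has_sum s) A" and "\<And>x. f x \<le> g x" "\<And>x. 0 \<le> f x"
  shows "\<exists>t\<le>s. (f has_sum t) A"
proof -
  have "f summable_on A"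
    using has_sum_imp_summable[OF g] by (rule summable_on_comparison_test) (use assms in auto)
  then have f: "(f has_sum infsum f A) A" by (rule has_sum_infsum)
  have "infsum f A \<le> s"
    using f g assms(2) by (rule has_sum_mono)
  with f show ?thesis by blast
qed

lemma norm_scaleR_mon_le:
  assumes "H \<in> mbox r"
  shows "norm (mon H \<alpha> *\<^sub>R x) \<le> norm x * r ^ mdeg \<alpha>"
  using mult_right_mono[OF abs_mon_le[OF assms, of \<alpha>] norm_ge_zero[of x]] by (simp add: mult.commute)

text \<open>The index set is the disjoint union of the fibres of m, and an unconditional sum over
  such a union may be taken fibre by fibre.\<close>

lemma fibre_has_sum:
  fixes g :: "'p \<Rightarrow> 'a::banach"
  assumes "(g has_sum s) UNIV" and "\<And>q. (g has_sum G q) {p. m p = q}"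
  shows "(G has_sum s) UNIV"
proof (rule has_sum_SigmaD[where B = "\<lambda>q. {p. m p = q}" and f = "\<lambda>x. g (snd x)"])
  show "((\<lambda>x. g (snd x)) has_sum s) (SIGMA q:UNIV. {p. m p = q})"
    using assms(1)
    by (subst has_sum_reindex_bij_witness[where i = "\<lambda>p. (m p, p)" and j = snd and T = UNIV and h = g and s' = s]) auto
  show "((\<lambda>y. g (snd (x, y))) has_sum G x) {p. m p = x}" for x
    using assms(2) by simp
qed

lemma ana_coeffsI:
  assumes "((\<lambda>\<alpha>. norm (c \<alpha>) * r ^ mdeg \<alpha>) has_sum s) UNIV" "s \<le> C"
    and "\<And>H. H \<in> mbox r \<Longrightarrow> ((\<lambda>\<alpha>. mon H \<alpha> *\<^sub>R c \<alpha>) has_sum f H) UNIV"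
  shows "ana r C f"
  unfolding ana_def using assms by (intro exI[of _ c] exI[of _ s]) simp

text \<open>A series that repeats monomials is good enough: p runs over any index set and
  \<open>m p\<close> is the exponent of its term. The coefficient at q collects the fibre over q,
  and the triangle inequality inside a fibre can only lower the weighted norm. Products use pairs of
  exponents here, series of functions use pairs (k, \<alpha>).\<close>

lemma anaI:
  fixes a :: "'p \<Rightarrow> 'a::banach" and f :: "real^'c^'r \<Rightarrow> 'a"
  assumes "0 < r" and s: "((\<lambda>p. norm (a p) * r ^ mdeg (m p)) has_sum s) UNIV" and "s \<le> C"
    and f: "\<And>H. H \<in> mbox r \<Longrightarrow> ((\<lambda>p. mon H (m p) *\<^sub>R a p) has_sum f H) UNIV"
  shows "ana r C f"
proof -
  define c where "c q = infsum a {p. m p = q}" for q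
  define d where "d q = infsum (\<lambda>p. norm (a p)) {p. m p = q}" for q
  have abs: "(\<lambda>p. norm (a p)) summable_on {p. m p = q}" for q
  proof -
    have "(\<lambda>p. norm (a p) * r ^ mdeg (m p)) summable_on {p. m p = q}"
      using summable_on_subset_banach[of _ UNIV] s summable_on_def by blast
    also have "?this \<longleftrightarrow> (\<lambda>p. norm (a p) * r ^ mdeg q) summable_on {p. m p = q}"
      by (rule summable_on_cong) auto
    also have "\<dots> \<longleftrightarrow> (\<lambda>p. norm (a p)) summable_on {p. m p = q}"
      by (rule summable_on_cmult_left') (use \<open>0 < r\<close> in simp)
    finally show ?thesis .
  qed
  have asum: "(a has_sum c q) {p. m p = q}" for q
    unfolding c_def by (rule has_sum_infsum[OF abs_summable_summable[OF abs]])
  have cd: "norm (c q) \<le> d q" for q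
    unfolding c_def d_def using abs by (rule norm_infsum_bound)
  have dsum: "((\<lambda>p. norm (a p)) has_sum d q) {p. m p = q}" for q
    unfolding d_def using abs by (rule has_sum_infsum)
  have d: "((\<lambda>q. d q * r ^ mdeg q) has_sum s) UNIV"
  proof (rule fibre_has_sum[OF s])
    show "((\<lambda>p. norm (a p) * r ^ mdeg (m p)) has_sum d q * r ^ mdeg q) {p. m p = q}" for q
      using has_sum_cmult_left[OF dsum[of q], of "r ^ mdeg q"]
      by (rule has_sum_cong[THEN iffD1, rotated]) auto
  qed
  have le: "norm (c q) * r ^ mdeg q \<le> d q * r ^ mdeg q" for q
    using cd \<open>0 < r\<close> by (intro mult_right_mono) auto
  obtain t where t: "t \<le> s" "((\<lambda>q. norm (c q) * r ^ mdeg q) has_sum t) UNIV"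
    using dominated_has_sum[OF d le] \<open>0 < r\<close> by auto
  have "((\<lambda>q. mon H q *\<^sub>R c q) has_sum f H) UNIV" if "H \<in> mbox r" for H
  proof (rule fibre_has_sum[OF f[OF that]])
    show "((\<lambda>p. mon H (m p) *\<^sub>R a p) has_sum mon H q *\<^sub>R c q) {p. m p = q}" for q
      using has_sum_scaleR[OF asum[of q], of "mon H q"]
      by (rule has_sum_cong[THEN iffD1, rotated]) auto
  qed
  moreover have "t \<le> C" using t(1) \<open>s \<le> C\<close> by simp
  ultimately show ?thesis using t(2) by (intro ana_coeffsI)
qed

lemma ana_mono: "ana r C f \<Longrightarrow> C \<le> D \<Longrightarrow> ana r D f"
  unfolding ana_def by (meson order_trans)

lemma ana_norm_le:
  assumes "ana r C f" "H \<in> mbox r"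
  shows "norm (f H) \<le> C"
proof -
  obtain c s where cs: "s \<le> C" "((\<lambda>\<alpha>. norm (c \<alpha>) * r ^ mdeg \<alpha>) has_sum s) UNIV"
     and f: "((\<lambda>\<alpha>. mon H \<alpha> *\<^sub>R c \<alpha>) has_sum f H) UNIV"
    using assms unfolding ana_def by blast
  obtain t where "t \<le> s" "((\<lambda>\<alpha>. norm (mon H \<alpha> *\<^sub>R c \<alpha>)) has_sum t) UNIV"
    using dominated_has_sum[OF cs(2) norm_scaleR_mon_le[OF assms(2)]] by auto
  with f have "norm (f H) \<le> s" using norm_has_sum_bound by fastforce
  then show ?thesis using cs(1) by simp
qed

lemma ana_const:
  fixes a :: "'a::banach"
  assumes "0 < r"
  shows "ana r (norm a) (\<lambda>_ :: real^'c^'r. a)"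
proof (rule anaI[where a = "\<lambda>_::unit. a" and m = "\<lambda>_ _ _. 0", OF assms])
  show "((\<lambda>p::unit. norm a * r ^ mdeg (\<lambda>(_::'r) (_::'c). 0)) has_sum norm a) UNIV"
    using has_sum_finite[of "UNIV :: unit set" "\<lambda>_. norm a"] by (simp add: mdeg_def)
  show "((\<lambda>p::unit. mon H (\<lambda>_ _. 0) *\<^sub>R a) has_sum a) UNIV" for H :: "real^'c^'r"
    using has_sum_finite[of "UNIV :: unit set" "\<lambda>_. a"] by (simp add: mon_def UNIV_unit del: has_sum_finite)
qed simp

text \<open>Every entry of H is a monomial of degree one and so contributes one factor r: all
  smallness on small boxes originates here. The constant is the sum of the norms of T at the matrix
  units.\<close>

lemma ana_linear_fun:
  fixes T :: "real^'c^'r \<Rightarrow> 'a::banach"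
  assumes "linear T"
  shows "\<exists>\<kappa>\<ge>0. \<forall>r>0. ana r (\<kappa> * r) T"
proof (intro exI conjI allI impI)
  define a where "a = (\<lambda>(i, j). T (axis i (axis j 1)))"
  show "0 \<le> (\<Sum>p\<in>UNIV. norm (a p))" by (simp add: sum_nonneg)
  fix r :: real assume r: "0 < r"
  define m :: "'r \<times> 'c \<Rightarrow> 'r \<Rightarrow> 'c \<Rightarrow> nat" where "m = (\<lambda>(i, j) k l. if k = i then (if l = j then 1 else 0) else 0)"
  have deg: "mdeg (m p) = 1" for p
  proof (cases p)
    case (Pair i j)
    have "(\<Sum>l\<in>UNIV. m (i, j) k l) = (if k = i then 1 else 0)" for k
      by (simp add: m_def)
    then show ?thesis by (simp add: mdeg_def Pair)
  qed
  have mon: "mon H (m p) = H $ fst p $ snd p" for H :: "real^'c^'r" and p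
  proof (cases p)
    case (Pair i j)
    have "(\<Prod>l\<in>UNIV. (H $ k $ l) ^ m (i, j) k l) = (if k = i then H $ i $ j else 1)" for k
    proof -
      have "(\<Prod>l\<in>UNIV. (H $ k $ l) ^ m (i, j) k l) = (\<Prod>l\<in>UNIV. if l = j then (if k = i then H $ i $ j else 1) else 1)"
        by (intro prod.cong) (auto simp: m_def)
      then show ?thesis by simp
    qed
    then show ?thesis by (simp add: mon_def Pair)
  qed
  show "ana r ((\<Sum>p\<in>UNIV. norm (a p)) * r) T"
  proof (rule anaI[where a = a and m = m, OF r])
    show "((\<lambda>p. norm (a p) * r ^ mdeg (m p)) has_sum (\<Sum>p\<in>UNIV. norm (a p)) * r) UNIV"
      unfolding deg power_one_right sum_distrib_right by (rule has_sum_finite) simp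
    fix H :: "real^'c^'r"
    have "H = (\<Sum>i\<in>UNIV. \<Sum>j\<in>UNIV. (H $ i $ j) *\<^sub>R axis i (axis j 1))"
    proof -
      have "(\<Sum>j\<in>UNIV. (if k = i then if l = j then H $ i $ j else 0 else 0)) = (if k = i then H $ k $ l else 0)" for k l i
        by simp
      then show ?thesis
        by (simp add: vec_eq_iff axis_def if_distrib[of "\<lambda>x. vec_nth x _"] if_distrib[of "(*) _"] cong: if_cong)
    qed
    then have "T H = T (\<Sum>i\<in>UNIV. \<Sum>j\<in>UNIV. (H $ i $ j) *\<^sub>R axis i (axis j 1))"
      by (rule arg_cong)
    also have "\<dots> = (\<Sum>i\<in>UNIV. \<Sum>j\<in>UNIV. (H $ i $ j) *\<^sub>R a (i, j))"
      by (simp add: linear_sum[OF assms] linear_scale[OF assms] a_def)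
    also have "\<dots> = (\<Sum>p\<in>UNIV. mon H (m p) *\<^sub>R a p)"
      by (simp add: mon sum.cartesian_product case_prod_unfold)
    finally show "((\<lambda>p. mon H (m p) *\<^sub>R a p) has_sum T H) UNIV"
      by (simp only: has_sum_finite finite_code)
  qed simp
qed

lemma ana_add:
  assumes "ana r C f" "ana r D g" "0 \<le> r"
  shows "ana r (C + D) (\<lambda>H. f H + g H)"
proof -
  obtain c s where c: "s \<le> C" "((\<lambda>\<alpha>. norm (c \<alpha>) * r ^ mdeg \<alpha>) has_sum s) UNIV"
     "\<And>H. H\<in>mbox r \<Longrightarrow> ((\<lambda>\<alpha>. mon H \<alpha> *\<^sub>R c \<alpha>) has_sum f H) UNIV"
    using assms unfolding ana_def by blast
  obtain d t where d: "t \<le> D" "((\<lambda>\<alpha>. norm (d \<alpha>) * r ^ mdeg \<alpha>) has_sum t) UNIV"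
     "\<And>H. H\<in>mbox r \<Longrightarrow> ((\<lambda>\<alpha>. mon H \<alpha> *\<^sub>R d \<alpha>) has_sum g H) UNIV"
    using assms unfolding ana_def by blast
  have *: "((\<lambda>\<alpha>. norm (c \<alpha>) * r ^ mdeg \<alpha> + norm (d \<alpha>) * r ^ mdeg \<alpha>) has_sum s + t) UNIV"
    using c(2) d(2) by (rule has_sum_add)
  have le: "norm (c \<alpha> + d \<alpha>) * r ^ mdeg \<alpha> \<le> norm (c \<alpha>) * r ^ mdeg \<alpha> + norm (d \<alpha>) * r ^ mdeg \<alpha>" for \<alpha>
    using mult_right_mono[OF norm_triangle_ineq[of "c \<alpha>" "d \<alpha>"], of "r ^ mdeg \<alpha>"] assms(3)
    by (simp add: distrib_right)
  obtain u where u: "u \<le> s + t" "((\<lambda>\<alpha>. norm (c \<alpha> + d \<alpha>) * r ^ mdeg \<alpha>) has_sum u) UNIV"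
    using dominated_has_sum[OF * le] assms(3) by auto
  have "((\<lambda>\<alpha>. mon H \<alpha> *\<^sub>R (c \<alpha> + d \<alpha>)) has_sum f H + g H) UNIV" if "H \<in> mbox r" for H
    unfolding scaleR_add_right using c(3)[OF that] d(3)[OF that] by (rule has_sum_add)
  moreover have "u \<le> C + D" using u(1) c(1) d(1) by simp
  ultimately show ?thesis using u(2) by (intro ana_coeffsI)
qed

lemma ana_linear:
  assumes "ana r C f" "0 < r" "bounded_linear T" "\<And>x. norm (T x) \<le> L * norm x" "0 \<le> L"
  shows "ana r (L * C) (\<lambda>H. T (f H))"
proof -
  obtain c s where c: "s \<le> C" "((\<lambda>\<alpha>. norm (c \<alpha>) * r ^ mdeg \<alpha>) has_sum s) UNIV"
     "\<And>H. H\<in>mbox r \<Longrightarrow> ((\<lambda>\<alpha>. mon H \<alpha> *\<^sub>R c \<alpha>) has_sum f H) UNIV"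
    using assms unfolding ana_def by blast
  interpret bounded_linear T by fact
  have *: "((\<lambda>\<alpha>. L * (norm (c \<alpha>) * r ^ mdeg \<alpha>)) has_sum L * s) UNIV"
    using c by (intro has_sum_cmult_right)
  have le: "norm (T (c \<alpha>)) * r ^ mdeg \<alpha> \<le> L * (norm (c \<alpha>) * r ^ mdeg \<alpha>)" for \<alpha>
    using mult_right_mono[OF assms(4)[of "c \<alpha>"], of "r ^ mdeg \<alpha>"] assms(2) by (simp add: mult.assoc)
  obtain u where u: "u \<le> L * s" "((\<lambda>\<alpha>. norm (T (c \<alpha>)) * r ^ mdeg \<alpha>) has_sum u) UNIV"
    using dominated_has_sum[OF * le] assms(2) by auto
  have "L * s \<le> L * C" using c(1) assms(5) by (rule mult_left_mono)
  with u(1) have "u \<le> L * C" by simp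
  moreover have "((\<lambda>\<alpha>. mon H \<alpha> *\<^sub>R T (c \<alpha>)) has_sum T (f H)) UNIV" if "H \<in> mbox r" for H
    using has_sum_bounded_linear[OF assms(3) c(3)[OF that]] by (simp add: scaleR)
  ultimately show ?thesis using u(2) by (intro ana_coeffsI)
qed

text \<open>The Cauchy product, indexed by pairs of exponents; \<open>anaI\<close> does the
  regrouping. The constant 1 in \<open>nT\<close> makes the weighted norm submultiplicative.\<close>

lemma ana_bilinear:
  fixes f :: "real^'c^'r \<Rightarrow> 'a::banach" and g :: "real^'c^'r \<Rightarrow> 'b::banach"
    and T :: "'a \<Rightarrow> 'b \<Rightarrow> 'd::banach"
  assumes "ana r C f" "ana r D g" "0 < r" and "bounded_bilinear T"
    and nT: "\<And>x y. norm (T x y) \<le> norm x * norm y"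
  shows "ana r (C * D) (\<lambda>H. T (f H) (g H))"
proof -
  obtain c s where c: "s \<le> C" "((\<lambda>\<alpha>. norm (c \<alpha>) * r ^ mdeg \<alpha>) has_sum s) UNIV"
     "\<And>H. H\<in>mbox r \<Longrightarrow> ((\<lambda>\<alpha>. mon H \<alpha> *\<^sub>R c \<alpha>) has_sum f H) UNIV"
    using assms(1) unfolding ana_def by blast
  obtain d t where d: "t \<le> D" "((\<lambda>\<alpha>. norm (d \<alpha>) * r ^ mdeg \<alpha>) has_sum t) UNIV"
     "\<And>H. H\<in>mbox r \<Longrightarrow> ((\<lambda>\<alpha>. mon H \<alpha> *\<^sub>R d \<alpha>) has_sum g H) UNIV"
    using assms(2) unfolding ana_def by blast
  interpret bounded_bilinear T by fact
  define w where "w = (\<lambda>(\<alpha>, \<gamma>). (norm (c \<alpha>) * r ^ mdeg \<alpha>) * (norm (d \<gamma>) * r ^ mdeg \<gamma>))"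
  define a where "a = (\<lambda>(\<alpha>, \<gamma>). T (c \<alpha>) (d \<gamma>))"
  define m :: "('r \<Rightarrow> 'c \<Rightarrow> nat) \<times> ('r \<Rightarrow> 'c \<Rightarrow> nat) \<Rightarrow> 'r \<Rightarrow> 'c \<Rightarrow> nat"
    where "m = (\<lambda>(\<alpha>, \<gamma>). (\<lambda>i j. \<alpha> i j + \<gamma> i j))"
  have wsum: "w summable_on UNIV \<times> UNIV"
  proof (rule summable_on_SigmaI)
    show "((\<lambda>\<gamma>. w (\<alpha>, \<gamma>)) has_sum (norm (c \<alpha>) * r ^ mdeg \<alpha>) * t) UNIV" for \<alpha>
      unfolding w_def using d(2) by (simp add: has_sum_cmult_right)
    show "(\<lambda>\<alpha>. (norm (c \<alpha>) * r ^ mdeg \<alpha>) * t) summable_on UNIV"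
      using c(2) by (intro summable_on_cmult_left) (auto simp: summable_on_def)
  qed (use assms(3) in \<open>auto simp: w_def\<close>)
  have ws: "(w has_sum s * t) UNIV"
    unfolding UNIV_Times_UNIV[symmetric]
  proof (rule has_sum_SigmaI[OF _ _ wsum])
    show "((\<lambda>\<gamma>. w (\<alpha>, \<gamma>)) has_sum (norm (c \<alpha>) * r ^ mdeg \<alpha>) * t) UNIV" for \<alpha>
      unfolding w_def using d(2) by (simp add: has_sum_cmult_right)
    show "((\<lambda>\<alpha>. (norm (c \<alpha>) * r ^ mdeg \<alpha>) * t) has_sum s * t) UNIV"
      using c(2) by (rule has_sum_cmult_left)
  qed
  have le: "norm (a p) * r ^ mdeg (m p) \<le> w p" for p
  proof (cases p)
    case (Pair \<alpha> \<gamma>)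
    have "norm (T (c \<alpha>) (d \<gamma>)) * (r ^ mdeg \<alpha> * r ^ mdeg \<gamma>) \<le> (norm (c \<alpha>) * norm (d \<gamma>)) * (r ^ mdeg \<alpha> * r ^ mdeg \<gamma>)"
      using nT assms(3) by (intro mult_right_mono) auto
    then show ?thesis
      unfolding Pair a_def w_def m_def prod.case mdeg_add power_add by (simp add: mult_ac)
  qed
  obtain u where u: "u \<le> s * t" "((\<lambda>p. norm (a p) * r ^ mdeg (m p)) has_sum u) UNIV"
    using dominated_has_sum[OF ws le] assms(3) by auto
  show ?thesis
  proof (rule anaI[where a = a and m = m, OF assms(3) u(2)])
    have "0 \<le> s" "0 \<le> t"
      using c(2) d(2) assms(3) by (auto intro: has_sum_nonneg)
    then have "s * t \<le> C * D" using c(1) d(1) by (intro mult_mono) auto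
    with u(1) show "u \<le> C * D" by simp
  next
    fix H :: "real^'c^'r" assume H: "H \<in> mbox r"
    have eq: "mon H (m (\<alpha>, \<gamma>)) *\<^sub>R a (\<alpha>, \<gamma>) = T (mon H \<alpha> *\<^sub>R c \<alpha>) (mon H \<gamma> *\<^sub>R d \<gamma>)" for \<alpha> \<gamma>
      by (simp add: m_def a_def mon_add scaleR_left scaleR_right)
    show "((\<lambda>p. mon H (m p) *\<^sub>R a p) has_sum T (f H) (g H)) UNIV"
      unfolding UNIV_Times_UNIV[symmetric]
    proof (rule has_sum_SigmaI)
      show "((\<lambda>\<gamma>. mon H (m (\<alpha>, \<gamma>)) *\<^sub>R a (\<alpha>, \<gamma>)) has_sum T (mon H \<alpha> *\<^sub>R c \<alpha>) (g H)) UNIV" for \<alpha>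
        unfolding eq using bounded_linear_right d(3)[OF H] by (rule has_sum_bounded_linear)
      show "((\<lambda>\<alpha>. T (mon H \<alpha> *\<^sub>R c \<alpha>) (g H)) has_sum T (f H) (g H)) UNIV"
        using bounded_linear_left c(3)[OF H] by (rule has_sum_bounded_linear)
      have "(\<lambda>p. norm (mon H (m p) *\<^sub>R a p)) summable_on UNIV"
        using dominated_has_sum[OF u(2) norm_scaleR_mon_le[OF H]] by (auto simp: summable_on_def)
      then show "(\<lambda>p. mon H (m p) *\<^sub>R a p) summable_on UNIV \<times> UNIV"
        by (simp add: abs_summable_summable)
    qed
  qed
qed


text \<open>Completeness of the algebra: the joint family over k and \<alpha> is absolutely
  summable, so the series of functions and the power series may be interchanged.\<close>

lemma ana_series:
  fixes f :: "nat \<Rightarrow> real^'c^'r \<Rightarrow> 'a::banach"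
  assumes f: "\<And>k. ana r (C k) (f k)" and "0 < r" and C: "(C has_sum D) UNIV"
  shows "\<And>H. H \<in> mbox r \<Longrightarrow> (\<lambda>k. f k H) sums (\<Sum>k. f k H)"
    and "ana r D (\<lambda>H. \<Sum>k. f k H)"
proof -
  have "\<forall>k. \<exists>c s. s \<le> C k \<and> ((\<lambda>\<alpha>. norm (c \<alpha>) * r ^ mdeg \<alpha>) has_sum s) UNIV \<and>
      (\<forall>H\<in>mbox r. ((\<lambda>\<alpha>. mon H \<alpha> *\<^sub>R c \<alpha>) has_sum f k H) UNIV)"
    using f unfolding ana_def by blast
  from choice[OF this] obtain c where "\<forall>k. \<exists>s. s \<le> C k \<and>
      ((\<lambda>\<alpha>. norm (c k \<alpha>) * r ^ mdeg \<alpha>) has_sum s) UNIV \<and>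
      (\<forall>H\<in>mbox r. ((\<lambda>\<alpha>. mon H \<alpha> *\<^sub>R c k \<alpha>) has_sum f k H) UNIV)" ..
  from choice[OF this] obtain s where "\<forall>k. s k \<le> C k \<and>
      ((\<lambda>\<alpha>. norm (c k \<alpha>) * r ^ mdeg \<alpha>) has_sum s k) UNIV \<and>
      (\<forall>H\<in>mbox r. ((\<lambda>\<alpha>. mon H \<alpha> *\<^sub>R c k \<alpha>) has_sum f k H) UNIV)" ..
  then have cs: "\<And>k. s k \<le> C k"
      "\<And>k. ((\<lambda>\<alpha>. norm (c k \<alpha>) * r ^ mdeg \<alpha>) has_sum s k) UNIV"
      "\<And>k H. H \<in> mbox r \<Longrightarrow> ((\<lambda>\<alpha>. mon H \<alpha> *\<^sub>R c k \<alpha>) has_sum f k H) UNIV"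
    by simp_all
  have s0: "0 \<le> s k" for k
    using cs(2)[of k] by (rule has_sum_nonneg) (use \<open>0 < r\<close> in auto)
  obtain t where t: "t \<le> D" "(s has_sum t) UNIV"
    using dominated_has_sum[OF C cs(1) s0] by blast
  show sums: "(\<lambda>k. f k H) sums (\<Sum>k. f k H)" if H: "H \<in> mbox r" for H
  proof -
    have "summable C" using C by (meson has_sum_imp_sums sums_summable)
    then have "summable (\<lambda>k. f k H)"
      by (rule summable_comparison_test') (rule ana_norm_le[OF f H])
    then show ?thesis by (rule summable_sums)
  qed
  define a where "a = (\<lambda>(k, \<alpha>). c k \<alpha>)"
  define w where "w = (\<lambda>p. norm (a p) * r ^ mdeg (snd p))"
  have w1: "((\<lambda>\<alpha>. w (k, \<alpha>)) has_sum s k) UNIV" for k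
    using cs(2) by (simp add: w_def a_def)
  have wsum: "w summable_on UNIV \<times> UNIV"
    by (rule summable_on_SigmaI[OF w1]) (use t(2) \<open>0 < r\<close> in \<open>auto simp: summable_on_def w_def\<close>)
  have ws: "(w has_sum t) UNIV"
    unfolding UNIV_Times_UNIV[symmetric] by (rule has_sum_SigmaI[OF w1 t(2) wsum])
  show "ana r D (\<lambda>H. \<Sum>k. f k H)"
  proof (rule anaI[where a = a and m = snd, OF \<open>0 < r\<close> ws[unfolded w_def] t(1)])
    fix H :: "real^'c^'r" assume H: "H \<in> mbox r"
    have "(\<lambda>p. norm (mon H (snd p) *\<^sub>R a p)) summable_on UNIV"
      using dominated_has_sum[OF ws[unfolded w_def] norm_scaleR_mon_le[OF H]] by (auto simp: summable_on_def)
    then have "(\<lambda>p. mon H (snd p) *\<^sub>R a p) summable_on UNIV"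
      by (rule abs_summable_summable)
    then obtain S where S: "((\<lambda>p. mon H (snd p) *\<^sub>R a p) has_sum S) (UNIV \<times> UNIV)"
      by (auto simp: summable_on_def)
    \<comment> \<open>Summing the joint family first over \<alpha> identifies its sum S with the
      pointwise series.\<close>
    have "((\<lambda>k. f k H) has_sum S) UNIV"
      using S by (rule has_sum_SigmaD) (use cs(3)[OF H] in \<open>simp add: a_def\<close>)
    then have "(\<lambda>k. f k H) sums S" by (rule has_sum_imp_sums)
    then have "S = (\<Sum>k. f k H)" by (rule sums_unique)
    with S show "((\<lambda>p. mon H (snd p) *\<^sub>R a p) has_sum (\<Sum>k. f k H)) UNIV"
      by simp
  qed
qed

section \<open>Matrix products under the Frobenius norm, and the quadratic fixed-point
  equation\<close>

lemma norm_matrix_mult_le: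
  fixes M :: "real^'b^'a" and N :: "real^'c^'b"
  shows "norm (M ** N) \<le> norm M * norm N"
proof -
  have row: "norm ((M ** N) $ i) \<le> norm (M $ i) * norm N" for i
  proof -
    have "(M ** N) $ i = (\<Sum>k\<in>UNIV. M $ i $ k *\<^sub>R N $ k)"
      by (simp add: vec_eq_iff matrix_matrix_mult_def)
    then have "norm ((M ** N) $ i) \<le> (\<Sum>k\<in>UNIV. \<bar>M $ i $ k\<bar> * \<bar>norm (N $ k)\<bar>)"
      using norm_sum[of "\<lambda>k. M $ i $ k *\<^sub>R N $ k" UNIV] by simp
    also have "\<dots> \<le> L2_set (\<lambda>k. M $ i $ k) UNIV * L2_set (\<lambda>k. norm (N $ k)) UNIV"
      by (rule L2_set_mult_ineq)
    also have "\<dots> = norm (M $ i) * norm N" by (simp add: norm_vec_def L2_set_def)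
    finally show ?thesis .
  qed
  have "norm (M ** N) \<le> L2_set (\<lambda>i. norm (M $ i) * norm N) UNIV"
    unfolding norm_vec_def[of "M ** N"] using row by (intro L2_set_mono) auto
  also have "\<dots> = norm M * norm N"
    by (simp add: norm_vec_def[of M] L2_set_left_distrib)
  finally show ?thesis .
qed

lemma bounded_bilinear_matrix_mult:
  "bounded_bilinear ((**) :: real^'b^'a \<Rightarrow> real^'c^'b \<Rightarrow> real^'c^'a)"
proof
  show "\<exists>K. \<forall>(a::real^'b^'a) (b::real^'c^'b). norm (a ** b) \<le> norm a * norm b * K"
    by (intro exI[of _ 1]) (simp add: norm_matrix_mult_le)
qed (simp_all add: vec_eq_iff matrix_matrix_mult_def sum.distrib sum_distrib_left distrib_left distrib_right mult.assoc mult.left_commute)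

interpretation matrix_mult: bounded_bilinear "(**) :: real^'b^'a \<Rightarrow> real^'c^'b \<Rightarrow> real^'c^'a"
  by (rule bounded_bilinear_matrix_mult)

lemma ana_matrix_mult:
  assumes "ana r C f" "ana r D g" "0 < r"
  shows "ana r (C * D) (\<lambda>H. (f H :: real^'b^'a) ** (g H :: real^'c^'b))"
  using assms bounded_bilinear_matrix_mult norm_matrix_mult_le by (rule ana_bilinear)

text \<open>The difference D of the solutions satisfies D = T E with E linear in D, and
  \<open>small\<close> makes T E at most half as large as D. It serves to show that a solution
  equals its own transpose.\<close>

lemma contraction_unique:
  fixes S :: "real^'n^'n" and T :: "real^'n^'n \<Rightarrow> real^'n^'n"
  assumes T: "linear T" "\<And>x. norm (T x) \<le> l * norm x" "0 \<le> l"
    and small: "norm N \<le> \<nu>" "norm N' \<le> \<nu>" "norm S \<le> \<sigma>" "l * (2 * \<nu> + 2 * \<rho> * \<sigma>) \<le> 1/2"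
    and Y: "norm Y \<le> \<rho>" "Y = T (P + N ** Y + Y ** N' + Y ** S ** Y)"
    and Z: "norm Z \<le> \<rho>" "Z = T (P + N ** Z + Z ** N' + Z ** S ** Z)"
  shows "Y = Z"
proof -
  define D where "D = Y - Z"
  \<comment> \<open>Y S Y - Z S Z is split as Y S D + D S Z, which respects the order of the
    factors.\<close>
  define E where "E = N ** D + D ** N' + (Y ** S ** D + D ** S ** Z)"
  have "E = (P + N ** Y + Y ** N' + Y ** S ** Y) - (P + N ** Z + Z ** N' + Z ** S ** Z)"
    by (simp add: E_def D_def matrix_mult.diff_left matrix_mult.diff_right)
  then have "T E = T (P + N ** Y + Y ** N' + Y ** S ** Y) - T (P + N ** Z + Z ** N' + Z ** S ** Z)"
    by (simp only: linear_diff[OF T(1)])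
  then have DT: "D = T E"
    unfolding D_def Y(2)[symmetric] Z(2)[symmetric] ..
  have "norm D \<le> norm D / 2"
  proof -
    have "0 \<le> \<rho>" "0 \<le> \<nu>" "0 \<le> \<sigma>"
      using Y(1) small norm_ge_zero order_trans by blast+
    have n1: "norm (N ** D) \<le> \<nu> * norm D"
      using norm_matrix_mult_le[of N D] mult_right_mono[OF small(1), of "norm D"] by simp
    have n2: "norm (D ** N') \<le> \<nu> * norm D"
      using norm_matrix_mult_le[of D N'] mult_left_mono[OF small(2), of "norm D"] by (simp add: mult.commute)
    have n3: "norm (Y ** S ** D) \<le> \<rho> * \<sigma> * norm D"
    proof -
      have "norm (Y ** S ** D) \<le> norm Y * norm S * norm D"
        using norm_matrix_mult_le[of "Y ** S" D] mult_right_mono[OF norm_matrix_mult_le[of Y S], of "norm D"] by simp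
      also have "\<dots> \<le> \<rho> * \<sigma> * norm D"
        using Y(1) small(3) \<open>0 \<le> \<rho>\<close> by (intro mult_right_mono mult_mono) auto
      finally show ?thesis .
    qed
    have n4: "norm (D ** S ** Z) \<le> \<rho> * \<sigma> * norm D"
    proof -
      have "norm (D ** S ** Z) \<le> norm D * norm S * norm Z"
        using norm_matrix_mult_le[of "D ** S" Z] mult_right_mono[OF norm_matrix_mult_le[of D S], of "norm Z"] by simp
      also have "\<dots> \<le> norm D * \<sigma> * \<rho>"
        using Z(1) small(3) \<open>0 \<le> \<sigma>\<close> by (intro mult_mono mult_left_mono) auto
      finally show ?thesis by (simp add: mult_ac)
    qed
    have "norm E \<le> (2 * \<nu> + 2 * \<rho> * \<sigma>) * norm D"
      unfolding E_def
      using norm_triangle_ineq[of "N ** D + D ** N'" "Y ** S ** D + D ** S ** Z"]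
        norm_triangle_ineq[of "N ** D" "D ** N'"] norm_triangle_ineq[of "Y ** S ** D" "D ** S ** Z"] n1 n2 n3 n4
      by (simp add: algebra_simps)
    then have "l * norm E \<le> l * ((2 * \<nu> + 2 * \<rho> * \<sigma>) * norm D)"
      using T(3) by (rule mult_left_mono)
    also have "\<dots> \<le> 1/2 * norm D"
      unfolding mult.assoc[symmetric] using mult_right_mono[OF small(4), of "norm D"] by (simp add: mult.assoc)
    finally show ?thesis using T(2)[of E] unfolding DT[symmetric] by linarith
  qed
  then have "D = 0" by (simp add: field_simps)
  then show ?thesis by (simp add: D_def)
qed

text \<open>Picard iteration from 0, run in the algebra and not pointwise. The first condition
  bounds the first step by \<rho> / 2, the second halves each further step; hence all iterates stay
  within \<rho> and the limit is a power series with the same bound.\<close>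

lemma ana_quadratic_fixpoint:
  fixes P N N' S :: "real^'c^'r \<Rightarrow> real^'n^'n" and T :: "real^'n^'n \<Rightarrow> real^'n^'n"
  assumes T: "linear T" "\<And>x. norm (T x) \<le> l * norm x" "0 \<le> l" and "0 < r" "0 \<le> \<rho>"
    and P: "ana r p P" and N: "ana r \<nu> N" and N': "ana r \<nu> N'" and S: "ana r \<sigma> S"
    and small: "l * p \<le> \<rho> / 2" "l * (2 * \<nu> + 2 * \<rho> * \<sigma>) \<le> 1/2"
  obtains Y where "ana r \<rho> Y"
    "\<And>H. H \<in> mbox r \<Longrightarrow> Y H = T (P H + N H ** Y H + Y H ** N' H + Y H ** S H ** Y H)"
proof -
  define \<Phi> where "\<Phi> H Y = T (P H + N H ** Y + Y ** N' H + Y ** S H ** Y)" for H Y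
  define y where "y k H = (\<Phi> H ^^ k) 0" for k H
  define d where "d k H = y (Suc k) H - y k H" for k H
  have blT: "bounded_linear T" using T(1) by (simp add: linear_linear)
  have d_Suc: "d (Suc k) H = T ((N H ** d k H + d k H ** N' H) + (y (Suc k) H ** S H ** d k H + d k H ** S H ** y k H))" for k H
  proof -
    have "d (Suc k) H = \<Phi> H (y (Suc k) H) - \<Phi> H (y k H)" by (simp add: d_def y_def)
    also have "\<dots> = T ((P H + N H ** y (Suc k) H + y (Suc k) H ** N' H + y (Suc k) H ** S H ** y (Suc k) H)
       - (P H + N H ** y k H + y k H ** N' H + y k H ** S H ** y k H))"
      unfolding \<Phi>_def linear_diff[OF T(1)] ..
    also have "(P H + N H ** y (Suc k) H + y (Suc k) H ** N' H + y (Suc k) H ** S H ** y (Suc k) H)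
       - (P H + N H ** y k H + y k H ** N' H + y k H ** S H ** y k H)
       = (N H ** d k H + d k H ** N' H) + (y (Suc k) H ** S H ** d k H + d k H ** S H ** y k H)"
      by (simp add: d_def matrix_mult.diff_left matrix_mult.diff_right)
    finally show ?thesis .
  qed
  \<comment> \<open>The formula for the next increment involves \<open>y k\<close> and
    \<open>y (Suc k)\<close>, so bounds of both travel with that of \<open>d k\<close>.\<close>
  have "ana r (\<rho> / 2 * (1/2) ^ k) (d k) \<and> ana r (\<rho> * (1 - (1/2) ^ k)) (y k) \<and> ana r (\<rho> * (1 - (1/2) ^ Suc k)) (y (Suc k))" for k
  proof (induction k)
    case 0
    have "y 0 = (\<lambda>_. 0)" by (simp add: y_def fun_eq_iff)
    then have y0: "ana r 0 (y 0)" using ana_const[OF \<open>0 < r\<close>, of "0 :: real^'n^'n"] by simp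
    have "ana r (l * p) (\<lambda>H. T (P H))" using P \<open>0 < r\<close> blT T(2,3) by (rule ana_linear)
    then have "ana r (\<rho> / 2) (\<lambda>H. T (P H))" using small(1) by (rule ana_mono)
    moreover have "y (Suc 0) = (\<lambda>H. T (P H))" "d 0 = (\<lambda>H. T (P H))"
      by (simp_all add: fun_eq_iff d_def y_def \<Phi>_def)
    ultimately show ?case using y0 by simp
  next
    case (Suc k)
    let ?q = "\<rho> / 2 * (1/2) ^ k"
    have q0: "0 \<le> ?q" using \<open>0 \<le> \<rho>\<close> by simp
    have yk: "ana r \<rho> (y k)" and ySk: "ana r \<rho> (y (Suc k))"
      using Suc.IH \<open>0 \<le> \<rho>\<close> by (auto elim!: ana_mono simp: mult_left_le)
    have dk: "ana r ?q (d k)" using Suc.IH by blast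
    have "ana r ((\<nu> * ?q + ?q * \<nu>) + (\<rho> * \<sigma> * ?q + ?q * \<sigma> * \<rho>))
      (\<lambda>H. (N H ** d k H + d k H ** N' H) + (y (Suc k) H ** S H ** d k H + d k H ** S H ** y k H))"
      using \<open>0 < r\<close> by (intro ana_add ana_matrix_mult N N' S dk yk ySk) simp_all
    from ana_linear[OF this \<open>0 < r\<close> blT T(2,3)]
    have "ana r (l * ((\<nu> * ?q + ?q * \<nu>) + (\<rho> * \<sigma> * ?q + ?q * \<sigma> * \<rho>))) (d (Suc k))"
      unfolding d_Suc[symmetric] .
    moreover have "l * ((\<nu> * ?q + ?q * \<nu>) + (\<rho> * \<sigma> * ?q + ?q * \<sigma> * \<rho>)) \<le> \<rho> / 2 * (1/2) ^ Suc k"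
    proof -
      have "l * ((\<nu> * ?q + ?q * \<nu>) + (\<rho> * \<sigma> * ?q + ?q * \<sigma> * \<rho>)) = (l * (2 * \<nu> + 2 * \<rho> * \<sigma>)) * ?q"
        by (simp add: algebra_simps)
      also have "\<dots> \<le> 1/2 * ?q" using small(2) q0 by (rule mult_right_mono)
      finally show ?thesis by simp
    qed
    ultimately have d: "ana r (\<rho> / 2 * (1/2) ^ Suc k) (d (Suc k))"
      by (rule ana_mono)
    have "y (Suc (Suc k)) = (\<lambda>H. y (Suc k) H + d (Suc k) H)" by (simp add: d_def)
    moreover have "ana r (\<rho> * (1 - (1/2) ^ Suc k) + \<rho> / 2 * (1/2) ^ Suc k) (\<lambda>H. y (Suc k) H + d (Suc k) H)"
      using Suc.IH d \<open>0 < r\<close> by (intro ana_add) auto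
    ultimately have "ana r (\<rho> * (1 - (1/2) ^ Suc (Suc k))) (y (Suc (Suc k)))"
      by (simp add: algebra_simps)
    then show ?case using d Suc.IH by simp
  qed
  then have d: "ana r (\<rho> / 2 * (1/2) ^ k) (d k)" for k by blast
  have "(\<lambda>k. \<rho> / 2 * (1/2) ^ k) sums (\<rho> / 2 * (1 / (1 - 1/2)))"
    by (intro sums_mult geometric_sums) simp
  then have C: "((\<lambda>k. \<rho> / 2 * (1/2) ^ k) has_sum \<rho>) UNIV"
    using \<open>0 \<le> \<rho>\<close> by (intro norm_summable_imp_has_sum) (auto simp: summable_mult summable_geometric)
  show thesis
  proof
    show "ana r \<rho> (\<lambda>H. \<Sum>k. d k H)" using d \<open>0 < r\<close> C by (rule ana_series)
    fix H :: "real^'c^'r" assume "H \<in> mbox r"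
    with d \<open>0 < r\<close> C have "(\<lambda>k. d k H) sums (\<Sum>k. d k H)" by (rule ana_series)
    moreover have "(\<Sum>k<n. d k H) = y n H" for n
      using sum_lessThan_telescope[of "\<lambda>k. y k H" n] by (simp add: d_def y_def)
    ultimately have lim: "(\<lambda>n. y n H) \<longlonglongrightarrow> (\<Sum>k. d k H)" (is "_ \<longlonglongrightarrow> ?y") by (simp add: sums_def)
    have 1: "(\<lambda>n. \<Phi> H (y n H)) \<longlonglongrightarrow> \<Phi> H ?y"
      unfolding \<Phi>_def using lim
      by (intro bounded_linear.tendsto[OF blT] tendsto_add matrix_mult.tendsto tendsto_const)
    have "(\<lambda>n. y (Suc n) H) \<longlonglongrightarrow> ?y" using lim by (rule LIMSEQ_Suc)
    moreover have "y (Suc n) H = \<Phi> H (y n H)" for n by (simp add: y_def)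
    ultimately have "(\<lambda>n. \<Phi> H (y n H)) \<longlonglongrightarrow> ?y" by (simp only:)
    from LIMSEQ_unique[OF this 1] show "?y = T (P H + N H ** ?y + ?y ** N' H + ?y ** S H ** ?y)"
      unfolding \<Phi>_def .
  qed
qed

section \<open>Hurwitz matrices\<close>

text \<open>Splitting complex vectors into real and imaginary parts makes the real inner product and
  the symmetry of real matrices available for eigenvectors.\<close>

definition cvec :: "real^'n \<Rightarrow> real^'n \<Rightarrow> complex^'n" where
  "cvec a b = (\<chi> i. Complex (a $ i) (b $ i))"

lemma cvec_cases: obtains a b where "v = cvec a b"
  by (rule that[of "\<chi> i. Re (v $ i)" "\<chi> i. Im (v $ i)"]) (simp add: cvec_def vec_eq_iff)

lemma cvec_eq_iff [simp]: "cvec a b = cvec c d \<longleftrightarrow> a = c \<and> b = d"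
  by (auto simp: cvec_def vec_eq_iff)

lemma cvec_0: "cvec 0 0 = 0"
  by (simp add: cvec_def vec_eq_iff zero_complex.code)

lemma cvec_diff: "cvec a b - cvec c d = cvec (a - c) (b - d)"
  by (simp add: cvec_def vec_eq_iff complex_eq_iff)

lemma cmat_mult_cvec: "cmat M *v cvec a b = cvec (M *v a) (M *v b)"
  by (simp add: cmat_def cvec_def vec_eq_iff matrix_vector_mult_def complex_eq_iff)

lemma scale_cvec: "l *s cvec a b = cvec (Re l *\<^sub>R a - Im l *\<^sub>R b) (Im l *\<^sub>R a + Re l *\<^sub>R b)"
  by (simp add: cvec_def vec_eq_iff complex_eq_iff)

lemma norm_cvec: "(norm (cvec a b))\<^sup>2 = (norm a)\<^sup>2 + (norm b)\<^sup>2"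
  by (simp add: norm_vec_def L2_set_def cvec_def cmod_power2 sum.distrib sum_nonneg)

lemma cmat_mult: "cmat (M ** N) = cmat M ** cmat N"
  by (simp add: cmat_def matrix_matrix_mult_def vec_eq_iff)

lemma norm_cmat_mult_le: "norm (cmat M *v v) \<le> norm M * norm v"
proof -
  have row: "norm ((cmat M *v v) $ i) \<le> norm (M $ i) * norm v" for i
  proof -
    have "norm ((cmat M *v v) $ i) \<le> (\<Sum>k\<in>UNIV. \<bar>M $ i $ k\<bar> * \<bar>norm (v $ k)\<bar>)"
      using norm_sum[of "\<lambda>k. complex_of_real (M $ i $ k) * v $ k" UNIV]
      by (simp add: matrix_vector_mult_def cmat_def norm_mult)
    also have "\<dots> \<le> L2_set (\<lambda>k. M $ i $ k) UNIV * L2_set (\<lambda>k. norm (v $ k)) UNIV"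
      by (rule L2_set_mult_ineq)
    also have "\<dots> = norm (M $ i) * norm v" by (simp add: norm_vec_def L2_set_def)
    finally show ?thesis .
  qed
  have "norm (cmat M *v v) \<le> L2_set (\<lambda>i. norm (M $ i) * norm v) UNIV"
    unfolding norm_vec_def[of "cmat M *v v"] using row by (intro L2_set_mono) auto
  also have "\<dots> = norm M * norm v"
    by (simp add: norm_vec_def[of M] L2_set_left_distrib)
  finally show ?thesis .
qed

lemma norm_scale: "norm (l *s v) = cmod l * norm v"
  by (simp add: norm_vec_def norm_mult L2_set_right_distrib)

lemma mat_mult_vec: "mat l *v v = (l :: complex) *s v"
  by (simp add: mat_def matrix_vector_mult_def vec_eq_iff if_distrib[of "\<lambda>x. x * _"] cong: if_cong)

definition eigenvalue_of :: "real^'n^'n \<Rightarrow> complex \<Rightarrow> bool" where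
  "eigenvalue_of M l \<longleftrightarrow> (\<exists>v. v \<noteq> 0 \<and> cmat M *v v = l *s v)"

lemma hurwitz_iff_eigenvalue: "hurwitz M \<longleftrightarrow> (\<forall>l. eigenvalue_of M l \<longrightarrow> Re l < 0)"
  by (auto simp: hurwitz_def eigenvalue_of_def)

text \<open>The determinant form is continuous in the matrix and in l, and invariant under
  transposition.\<close>

lemma eigenvalue_of_iff_det: "eigenvalue_of M l \<longleftrightarrow> det (mat l - cmat M) = 0"
proof -
  have "eigenvalue_of M l \<longleftrightarrow> (\<exists>v. v \<noteq> 0 \<and> (mat l - cmat M) *v v = 0)"
    unfolding eigenvalue_of_def by (auto simp: matrix_vector_mult_diff_rdistrib mat_mult_vec)
  also have "\<dots> \<longleftrightarrow> \<not> invertible (mat l - cmat M)"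
    unfolding invertible_left_inverse matrix_left_invertible_ker by blast
  finally show ?thesis by (simp add: invertible_det_nz)
qed

lemma eigenvalue_of_transpose: "eigenvalue_of (transpose M) l \<longleftrightarrow> eigenvalue_of M l"
proof -
  have "mat l - cmat (transpose M) = transpose (mat l - cmat M)"
    by (auto simp: cmat_def transpose_def mat_def vec_eq_iff)
  then show ?thesis by (simp add: eigenvalue_of_iff_det)
qed

lemma hurwitz_transpose: "hurwitz (transpose M) \<longleftrightarrow> hurwitz M"
  by (simp add: hurwitz_iff_eigenvalue eigenvalue_of_transpose)

lemma eigenvalue_norm_le:
  assumes "eigenvalue_of M l"
  shows "cmod l \<le> norm M"
proof -
  obtain v where "v \<noteq> 0" "cmat M *v v = l *s v" using assms by (auto simp: eigenvalue_of_def)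
  then show ?thesis using norm_cmat_mult_le[of M v] by (simp add: norm_scale)
qed

lemma det_tendsto:
  fixes M :: "'a \<Rightarrow> complex^'n^'n"
  assumes "\<And>i j. ((\<lambda>x. M x $ i $ j) \<longlongrightarrow> L $ i $ j) F"
  shows "((\<lambda>x. det (M x)) \<longlongrightarrow> det L) F"
  unfolding det_def by (intro tendsto_sum tendsto_mult tendsto_prod tendsto_const assms)

lemma charpoly_tendsto:
  assumes "(M \<longlongrightarrow> L) F" "(z \<longlongrightarrow> l) F"
  shows "((\<lambda>x. det (mat (z x) - cmat (M x))) \<longlongrightarrow> det (mat l - cmat L)) F"
proof (rule det_tendsto)
  fix i j
  have "((\<lambda>x. M x $ i $ j) \<longlongrightarrow> L $ i $ j) F"
    using assms(1) by (intro tendsto_vec_nth)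
  then show "((\<lambda>x. (mat (z x) - cmat (M x)) $ i $ j) \<longlongrightarrow> (mat l - cmat L) $ i $ j) F"
    using assms(2) by (cases "i = j") (auto simp: mat_def cmat_def intro!: tendsto_intros)
qed

text \<open>The complement is closed: eigenvalues are bounded by the norms of the matrices, so those
  with nonnegative real part have a convergent subsequence, and the characteristic determinant
  passes to the limit.\<close>

lemma hurwitz_open: "open {M. hurwitz M}"
proof -
  have "closed {M :: real^'n^'n. \<not> hurwitz M}"
    unfolding closed_sequential_limits
  proof (intro allI impI, elim conjE)
    fix M and L :: "real^'n^'n"
    assume M: "\<forall>k. M k \<in> {M. \<not> hurwitz M}" and lim: "M \<longlonglongrightarrow> L"
    then have "\<forall>k. \<exists>l. eigenvalue_of (M k) l \<and> 0 \<le> Re l"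
      by (auto simp: hurwitz_iff_eigenvalue not_less)
    then obtain l where l: "\<And>k. eigenvalue_of (M k) (l k)" "\<And>k. 0 \<le> Re (l k)" by metis
    have "bounded (range M)" using lim by (rule convergent_imp_bounded)
    then obtain b where "\<And>k. norm (M k) \<le> b" by (auto simp: bounded_iff)
    then have "bounded (range l)"
      using eigenvalue_norm_le[OF l(1)] by (auto simp: bounded_iff intro: order_trans)
    then obtain l0 s where s: "strict_mono s" "(l \<circ> s) \<longlonglongrightarrow> l0"
      using bounded_imp_convergent_subsequence by blast
    have "(\<lambda>k. det (mat ((l \<circ> s) k) - cmat ((M \<circ> s) k))) \<longlonglongrightarrow> det (mat l0 - cmat L)"
      using LIMSEQ_subseq_LIMSEQ[OF lim s(1)] s(2) by (rule charpoly_tendsto)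
    moreover have "(\<lambda>k. det (mat ((l \<circ> s) k) - cmat ((M \<circ> s) k))) = (\<lambda>_. 0)"
      using l(1) by (simp add: eigenvalue_of_iff_det)
    ultimately have "det (mat l0 - cmat L) = 0"
      by (simp add: LIMSEQ_const_iff)
    moreover have "0 \<le> Re l0"
      using tendsto_Re[OF s(2)] l(2) by (intro LIMSEQ_le_const[of _ "Re l0"]) auto
    ultimately show "L \<in> {M. \<not> hurwitz M}"
      by (auto simp: hurwitz_iff_eigenvalue eigenvalue_of_iff_det not_less)
  qed
  then show ?thesis by (simp add: closed_def Compl_eq)
qed

text \<open>The characteristic polynomials of the \<open>M k\<close> have no zero in the open right
  half plane and converge locally uniformly. By Hurwitz's theorem on zeros the nonconstant limit has
  none there either.\<close>

lemma hurwitz_limit_eigenvalue: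
  fixes M :: "nat \<Rightarrow> real^'n^'n"
  assumes M: "\<And>k. hurwitz (M k)" and lim: "M \<longlonglongrightarrow> L" and l: "eigenvalue_of L l"
  shows "Re l \<le> 0"
proof (rule ccontr)
  assume "\<not> Re l \<le> 0"
  let ?S = "{z. 0 < Re z}"
  have "det (mat l - cmat L) \<noteq> 0"
  proof (rule Hurwitz_no_zeros[where S = ?S and \<F> = "\<lambda>k z. det (mat z - cmat (M k))" and g = "\<lambda>z. det (mat z - cmat L)"])
    show "open ?S" by (rule open_halfspace_Re_gt)
    show "connected ?S" by (intro convex_connected convex_halfspace_Re_gt)
    have entry: "(\<lambda>z. (mat z - cmat N) $ i $ j) holomorphic_on UNIV" for N :: "real^'n^'n" and i j
      by (cases "i = j") (auto simp: mat_def intro!: holomorphic_intros)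
    have hol: "(\<lambda>z. det (mat z - cmat N)) holomorphic_on UNIV" for N :: "real^'n^'n"
      unfolding det_def using entry by (intro holomorphic_intros)
    then show "(\<lambda>z. det (mat z - cmat (M n))) holomorphic_on ?S" "(\<lambda>z. det (mat z - cmat L)) holomorphic_on ?S" for n
      by (auto intro: holomorphic_on_subset)
    \<comment> \<open>If this failed, points of K would violate the bound e along a subsequence; at
      a limit point w of them, joint continuity of the determinant makes the distance tend to
      0.\<close>
    show "uniform_limit K (\<lambda>n z. det (mat z - cmat (M n))) (\<lambda>z. det (mat z - cmat L)) sequentially"
      if "compact K" "K \<subseteq> ?S" for K
    proof (rule uniform_limitI, rule ccontr)
      fix e :: real assume e: "0 < e" and
        "\<not> (\<forall>\<^sub>F n in sequentially. \<forall>z\<in>K. dist (det (mat z - cmat (M n))) (det (mat z - cmat L)) < e)"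
      then have "\<exists>\<^sub>F n in sequentially. \<exists>z\<in>K. e \<le> dist (det (mat z - cmat (M n))) (det (mat z - cmat L))"
        by (simp add: not_eventually not_less)
      then have "\<exists>\<^sub>\<infinity>n. \<exists>z\<in>K. e \<le> dist (det (mat z - cmat (M n))) (det (mat z - cmat L))"
        by (simp add: cofinite_eq_sequentially)
      then have inf: "infinite {n. \<exists>z\<in>K. e \<le> dist (det (mat z - cmat (M n))) (det (mat z - cmat L))}"
        by (simp add: frequently_cofinite)
      obtain s :: "nat \<Rightarrow> nat" where s: "strict_mono s"
          "\<And>n. s n \<in> {n. \<exists>z\<in>K. e \<le> dist (det (mat z - cmat (M n))) (det (mat z - cmat L))}"
        using infinite_enumerate[OF inf] by blast
      then have "\<forall>n. \<exists>z\<in>K. e \<le> dist (det (mat z - cmat (M (s n)))) (det (mat z - cmat L))" by blast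
      then obtain z where z: "\<And>n. z n \<in> K"
          "\<And>n. e \<le> dist (det (mat (z n) - cmat (M (s n)))) (det (mat (z n) - cmat L))" by metis
      obtain w q where q: "strict_mono q" "(z \<circ> q) \<longlonglongrightarrow> w"
        using \<open>compact K\<close> z(1) unfolding compact_def by metis
      have sq: "(\<lambda>n. M (s (q n))) \<longlonglongrightarrow> L"
        using LIMSEQ_subseq_LIMSEQ[OF lim strict_mono_o[OF s(1) q(1)]] by (simp add: o_def)
      have "(\<lambda>n. dist (det (mat ((z \<circ> q) n) - cmat (M (s (q n))))) (det (mat ((z \<circ> q) n) - cmat L)))
          \<longlonglongrightarrow> dist (det (mat w - cmat L)) (det (mat w - cmat L))"
        using sq q(2) by (intro tendsto_dist charpoly_tendsto tendsto_const)
      then have "e \<le> dist (det (mat w - cmat L)) (det (mat w - cmat L))"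
        by (rule LIMSEQ_le_const) (use z(2) in auto)
      with e show False by simp
    qed
    \<comment> \<open>The constant would be 0 because l is a zero, so every point of the half plane
      would be an eigenvalue of L, among them \<open>norm L + 1\<close>, beyond the norm
      bound.\<close>
    show "\<not> (\<lambda>z. det (mat z - cmat L)) constant_on ?S"
    proof
      assume "(\<lambda>z. det (mat z - cmat L)) constant_on ?S"
      then obtain c where c: "\<And>z. 0 < Re z \<Longrightarrow> det (mat z - cmat L) = c"
        by (auto simp: constant_on_def)
      have "eigenvalue_of L l'" if "0 < Re l'" for l'
        using c[OF that] c[of l] l \<open>\<not> Re l \<le> 0\<close> by (auto simp: eigenvalue_of_iff_det)
      from eigenvalue_norm_le[OF this, of "complex_of_real (norm L + 1)"] show False
        by (simp add: add_nonneg_pos del: of_real_add)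
    qed
    show "det (mat z - cmat (M n)) \<noteq> 0" if "z \<in> ?S" for n z
      using M[of n] that by (auto simp: hurwitz_iff_eigenvalue eigenvalue_of_iff_det)
    show "l \<in> ?S" using \<open>\<not> Re l \<le> 0\<close> by simp
  qed
  with l show False by (simp add: eigenvalue_of_iff_det)
qed

section \<open>Sylvester equations\<close>

text \<open>The vector p(G) v, formed from the iterates of G on v so that matrix powers never
  occur.\<close>

definition poly_matrix_vec :: "complex^'n^'n \<Rightarrow> complex poly \<Rightarrow> complex^'n \<Rightarrow> complex^'n" where
  "poly_matrix_vec G p v = (\<Sum>i\<le>degree p. coeff p i *s (((*v) G) ^^ i) v)"

lemma poly_matrix_vec_eq:
  assumes "degree p \<le> N"
  shows "poly_matrix_vec G p v = (\<Sum>i\<le>N. coeff p i *s (((*v) G) ^^ i) v)"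
  unfolding poly_matrix_vec_def
  by (rule sum.mono_neutral_left) (use assms in \<open>auto simp: coeff_eq_0 not_le\<close>)

lemma funpow_matrix_linear:
  fixes G :: "complex^'n^'n"
  shows "(((*v) G) ^^ i) (u - l *s w) = (((*v) G) ^^ i) u - l *s (((*v) G) ^^ i) w"
  by (induction i) (simp_all add: matrix_vector_mult_diff_distrib vector_scalar_commute)

lemma poly_matrix_vec_diff_scale:
  "poly_matrix_vec G p (u - l *s w) = poly_matrix_vec G p u - l *s poly_matrix_vec G p w"
  by (simp add: poly_matrix_vec_def funpow_matrix_linear vec.scale_right_diff_distrib sum_subtractf
      vec.scale_sum_right mult.commute)

lemma poly_matrix_vec_commute: "poly_matrix_vec G p (G *v v) = G *v poly_matrix_vec G p v"
proof -
  have "(((*v) G) ^^ i) (G *v v) = G *v (((*v) G) ^^ i) v" for i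
    by (simp add: funpow_swap1)
  then show ?thesis
    by (simp add: poly_matrix_vec_def vec.linear_sum[OF matrix_vector_mul_linear_gen] vector_scalar_commute)
qed

lemma poly_matrix_vec_linear_factor:
  "poly_matrix_vec G ([:-l, 1:] * q) v = poly_matrix_vec G q (G *v v - l *s v)"
proof -
  let ?N = "Suc (degree q)" and ?f = "\<lambda>i. (((*v) G) ^^ i)"
  have "degree ([:-l, 1:] * q) \<le> ?N"
    by (rule order_trans[OF degree_mult_le]) simp
  then have "poly_matrix_vec G ([:-l, 1:] * q) v = (\<Sum>i\<le>?N. coeff ([:-l, 1:] * q) i *s ?f i v)"
    by (rule poly_matrix_vec_eq)
  also have "\<dots> = (\<Sum>i\<le>?N. coeff (pCons 0 q) i *s ?f i v) - (\<Sum>i\<le>?N. (l * coeff q i) *s ?f i v)"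
  proof -
    have "coeff ([:-l, 1:] * q) i *s ?f i v = coeff (pCons 0 q) i *s ?f i v - (l * coeff q i) *s ?f i v" for i
    proof -
      have "coeff ([:-l, 1:] * q) i = coeff (pCons 0 q) i - l * coeff q i" by simp
      then show ?thesis by (simp only: vec.scale_left_diff_distrib)
    qed
    then show ?thesis by (simp only: sum_subtractf)
  qed
  also have "(\<Sum>i\<le>?N. coeff (pCons 0 q) i *s ?f i v) = poly_matrix_vec G q (G *v v)"
    by (simp add: poly_matrix_vec_def sum.atMost_Suc_shift funpow_swap1 del: sum.atMost_Suc)
  also have "(\<Sum>i\<le>?N. (l * coeff q i) *s ?f i v) = l *s poly_matrix_vec G q v"
    by (simp add: poly_matrix_vec_def vec.scale_sum_right coeff_eq_0)
  finally show ?thesis by (simp add: poly_matrix_vec_diff_scale)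
qed

text \<open>The vectors v, G v, ..., G^n v with n = CARD('n) are linearly dependent. Dependence is a
  notion for sets, so a repetition among them is a separate case, where the difference of two
  indicators serves as the relation.\<close>

lemma exists_annihilating_poly:
  fixes G :: "complex^'n^'n"
  shows "\<exists>p. p \<noteq> 0 \<and> poly_matrix_vec G p v = 0"
proof -
  let ?n = "CARD('n)" and ?f = "\<lambda>i. (((*v) G) ^^ i) v"
  have "\<exists>c. (\<exists>i\<le>?n. c i \<noteq> 0) \<and> (\<Sum>i\<le>?n. c i *s ?f i) = 0"
  proof (cases "inj_on ?f {..?n}")
    case True
    have "card (?f ` {..?n}) = Suc ?n" using card_image[OF True] by simp
    moreover have "card S \<le> ?n" if "vec.independent S" for S :: "(complex^'n) set"
      using vec.independent_card_le_dim[OF subset_UNIV that] by (simp only: vec_dim_card)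
    ultimately have "vec.dependent (?f ` {..?n})" by fastforce
    then obtain u w where u: "w \<in> ?f ` {..?n}" "u w \<noteq> 0" "(\<Sum>w\<in>?f ` {..?n}. u w *s w) = 0"
      unfolding vec.dependent_finite[OF finite_imageI[OF finite_atMost]] by blast
    from u(3) have "(\<Sum>i\<le>?n. u (?f i) *s ?f i) = 0"
      by (simp add: sum.reindex[OF True])
    with u(1,2) show ?thesis by (intro exI[of _ "\<lambda>i. u (?f i)"]) auto
  next
    case False
    then obtain i j where ij: "i \<le> ?n" "j \<le> ?n" "i \<noteq> j" "?f i = ?f j"
      by (auto simp: inj_on_def)
    let ?c = "\<lambda>k. (if k = i then 1 else 0) - (if k = j then 1 else (0::complex))"
    have "(\<Sum>k\<le>?n. ?c k *s ?f k) = (\<Sum>k\<le>?n. if k = i then ?f k else 0) - (\<Sum>k\<le>?n. if k = j then ?f k else 0)"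
      by (simp only: sum_subtractf[symmetric]) (auto intro!: sum.cong simp: vec.scale_left_diff_distrib)
    also have "\<dots> = 0" using ij by simp
    finally show ?thesis using ij by (intro exI[of _ ?c]) auto
  qed
  then obtain c i where c: "i \<le> ?n" "c i \<noteq> 0" "(\<Sum>i\<le>?n. c i *s ?f i) = 0" by blast
  define p where "p = (\<Sum>i\<le>?n. monom (c i) i)"
  have coeff: "coeff p k = (if k \<le> ?n then c k else 0)" for k
    by (simp add: p_def coeff_sum)
  then have "degree p \<le> ?n" by (intro degree_le) auto
  then have "poly_matrix_vec G p v = 0" using c(3) by (simp add: poly_matrix_vec_eq coeff)
  moreover have "p \<noteq> 0" using coeff[of i] c by auto
  ultimately show ?thesis by blast
qed

text \<open>\<open>disj\<close> says that F and G share no eigenvalue. Induction on the degree of a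
  polynomial p = (x - l) q annihilating v: the hypothesis at G v - l v gives F (D v) = l D v. If D v
  is nonzero, l is not an eigenvalue of G, so q(G) v, which G scales by l, is zero; then q already
  annihilates v, and the hypothesis gives D v = 0.\<close>

lemma intertwining_zero:
  fixes F G D :: "complex^'n^'n"
  assumes FD: "F ** D = D ** G"
    and disj: "\<And>l u w. u \<noteq> 0 \<Longrightarrow> F *v u = l *s u \<Longrightarrow> G *v w = l *s w \<Longrightarrow> w = 0"
  shows "D = 0"
proof -
  have FDv: "F *v (D *v v) = D *v (G *v v)" for v
    using FD by (simp add: matrix_vector_mul_assoc)
  have "D *v v = 0" if "p \<noteq> 0" "poly_matrix_vec G p v = 0" for p v
    using that
  proof (induction "degree p" arbitrary: p v rule: less_induct)
    case less
    show ?case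
    proof (cases "degree p = 0")
      case True
      then have "coeff p 0 *s v = 0" "coeff p 0 \<noteq> 0"
        using less.prems leading_coeff_0_iff[of p] by (auto simp: poly_matrix_vec_def)
      then have "v = 0" by simp
      then show ?thesis by simp
    next
      case False
      then obtain l where "poly p l = 0"
        using fundamental_theorem_of_algebra[of p] constant_degree[of p] by metis
      then obtain q where q: "p = [:-l, 1:] * q" by (auto simp: poly_eq_0_iff_dvd)
      with less.prems(1) have "q \<noteq> 0" by auto
      then have deg: "degree q < degree p" unfolding q by (subst degree_mult_eq) auto
      have w: "poly_matrix_vec G q (G *v v - l *s v) = 0"
        using less.prems(2) unfolding q poly_matrix_vec_linear_factor .
      then have "D *v (G *v v - l *s v) = 0" using less.hyps[OF deg \<open>q \<noteq> 0\<close>] by blast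
      then have eig: "F *v (D *v v) = l *s (D *v v)"
        by (simp add: FDv matrix_vector_mult_diff_distrib vector_scalar_commute)
      show ?thesis
      proof (rule ccontr)
        assume nz: "D *v v \<noteq> 0"
        have "G *v poly_matrix_vec G q v = l *s poly_matrix_vec G q v"
          using w by (simp add: poly_matrix_vec_diff_scale poly_matrix_vec_commute)
        then have "poly_matrix_vec G q v = 0" using disj[OF nz eig] by blast
        with less.hyps[OF deg \<open>q \<noteq> 0\<close>] nz show False by blast
      qed
    qed
  qed
  then have "D *v v = 0" for v using exists_annihilating_poly by blast
  then show ?thesis by (simp add: matrix_eq)
qed

text \<open>D intertwines F with the negated transpose of G, and their eigenvalues lie in the open
  left and the open right half plane.\<close>

lemma sylvester_unique:
  fixes F G D :: "real^'n^'n"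
  assumes "hurwitz F" "hurwitz G" and eq: "F ** D + D ** transpose G = 0"
  shows "D = 0"
proof -
  have "F ** D = D ** (- transpose G)"
  proof -
    have "D ** (- transpose G) = - (D ** transpose G)" by (simp add: matrix_mult.minus_right)
    with eq show ?thesis by (metis eq_neg_iff_add_eq_0)
  qed
  then have c: "cmat F ** cmat D = cmat D ** cmat (- transpose G)" by (simp add: cmat_mult[symmetric])
  have "cmat D = 0"
  proof (rule intertwining_zero[OF c])
    fix l u w assume u: "u \<noteq> 0" "cmat F *v u = l *s u" and w: "cmat (- transpose G) *v w = l *s w"
    show "w = 0"
    proof (rule ccontr)
      assume "w \<noteq> 0"
      have "cmat (- transpose G) *v w = - (cmat (transpose G) *v w)"
        by (simp add: cmat_def matrix_vector_mult_def vec_eq_iff sum_negf)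
      with w have "cmat (transpose G) *v w = (- l) *s w" by (metis minus_minus vec.scale_minus_left)
      with \<open>w \<noteq> 0\<close> have "eigenvalue_of (transpose G) (- l)" by (auto simp: eigenvalue_of_def)
      then have "Re (- l) < 0" using assms(2) hurwitz_transpose hurwitz_iff_eigenvalue by blast
      moreover have "Re l < 0" using u assms(1) by (auto simp: hurwitz_def)
      ultimately show False by simp
    qed
  qed
  then show ?thesis by (simp add: cmat_def vec_eq_iff)
qed

section \<open>Square roots of positive definite matrices\<close>

lemma inner_matrix_mult_transpose: "x \<bullet> (M *v y) = (transpose M *v x) \<bullet> (y :: real^'n)"
  by (simp add: dot_lmul_matrix)

lemma symmetric_mat_inner: "symmetric_mat M \<Longrightarrow> x \<bullet> (M *v y) = (M *v x) \<bullet> y"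
  using inner_matrix_mult_transpose[of x M y] by (simp add: symmetric_mat_def del: transpose_matrix_vector)

lemma norm_matrix_vector_le: "norm (M *v v) \<le> norm M * norm (v :: real^'n)"
proof -
  have "(norm (cmat M *v cvec v 0))\<^sup>2 \<le> (norm M * norm (cvec v 0))\<^sup>2"
    by (intro power_mono norm_cmat_mult_le) simp
  then have "(norm (M *v v))\<^sup>2 \<le> (norm M * norm v)\<^sup>2"
    by (simp add: cmat_mult_cvec norm_cvec power_mult_distrib)
  then show ?thesis by (rule power2_le_imp_le) simp
qed

lemma sphere_nonempty: "sphere 0 1 \<noteq> ({} :: (real^'n) set)"
  using vector_choose_size[of 1, where 'a = "real^'n"] by auto

lemma pd_coercive:
  fixes Q :: "real^'n^'n"
  assumes "pd Q"
  shows "\<exists>q>0. \<forall>x. q * (norm x)\<^sup>2 \<le> x \<bullet> (Q *v x)"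
proof -
  have "continuous_on (sphere 0 1) (\<lambda>x. x \<bullet> (Q *v x))"
    by (intro continuous_intros linear_continuous_on) (simp add: matrix_vector_mul_bounded_linear)
  then obtain z where z: "norm z = 1" "\<And>x. norm x = 1 \<Longrightarrow> z \<bullet> (Q *v z) \<le> x \<bullet> (Q *v x)"
    using continuous_attains_inf[OF compact_sphere sphere_nonempty, where f = "\<lambda>x. x \<bullet> (Q *v x)"] by auto
  have "z \<bullet> (Q *v z) * (norm x)\<^sup>2 \<le> x \<bullet> (Q *v x)" for x
  proof (cases "x = 0")
    case False
    have "z \<bullet> (Q *v z) \<le> (x /\<^sub>R norm x) \<bullet> (Q *v (x /\<^sub>R norm x))"
      using False by (intro z(2)) simp
    also have "\<dots> = (x \<bullet> (Q *v x)) / (norm x)\<^sup>2"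
      by (simp add: matrix_vector_mult_scaleR power2_eq_square field_simps)
    finally show ?thesis using False by (simp add: field_simps)
  qed simp
  moreover have "0 < z \<bullet> (Q *v z)" using assms z(1) unfolding pd_def by (metis norm_zero zero_neq_one)
  ultimately show ?thesis by blast
qed

text \<open>The form of -P, summed over the real and imaginary parts of an eigenvector, is Re l
  times the squared norm. This brings square roots within reach of the Sylvester argument.\<close>

lemma pd_hurwitz_minus:
  assumes "pd P"
  shows "hurwitz (- P)"
  unfolding hurwitz_def
proof (intro allI impI, elim conjE)
  fix l v assume "v \<noteq> 0" and eq: "cmat (- P) *v v = l *s v"
  obtain a b where v: "v = cvec a b" by (rule cvec_cases)
  have ab: "a \<noteq> 0 \<or> b \<noteq> 0" using \<open>v \<noteq> 0\<close> by (auto simp: v cvec_0)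
  have m: "- P *v x = - (P *v x)" for x by (simp add: matrix_vector_mult_def vec_eq_iff sum_negf)
  have e: "- (P *v a) = Re l *\<^sub>R a - Im l *\<^sub>R b" "- (P *v b) = Im l *\<^sub>R a + Re l *\<^sub>R b"
    using eq unfolding v cmat_mult_cvec scale_cvec cvec_eq_iff m by auto
  have "a \<bullet> - (P *v a) + b \<bullet> - (P *v b) = Re l * ((norm a)\<^sup>2 + (norm b)\<^sup>2)"
    unfolding e by (simp add: inner_diff_right inner_add_right inner_commute[of a b] power2_norm_eq_inner distrib_left)
  moreover have "0 < a \<bullet> (P *v a) + b \<bullet> (P *v b)"
    using ab assms unfolding pd_def
    by (cases "a = 0"; cases "b = 0") (auto intro: add_pos_pos)
  ultimately have "Re l * ((norm a)\<^sup>2 + (norm b)\<^sup>2) < 0" by simp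
  then show "Re l < 0" using sum_power2_ge_zero[of "norm a" "norm b"] by (simp add: mult_less_0_iff)
qed

text \<open>If the form of P vanished at x, a small move in the direction -P x would make it
  negative: the slope there is -2 |P x|^2 = -2 x . Q x, which is not zero.\<close>

lemma psd_sqrt_pd:
  fixes P Q :: "real^'n^'n"
  assumes P: "psd P" "P ** P = Q" and Q: "pd Q"
  shows "pd P"
  unfolding pd_def
proof (intro conjI allI impI)
  show "symmetric_mat P" using P(1) by (simp add: psd_def)
  then have sym: "x \<bullet> (P *v y) = (P *v x) \<bullet> y" for x y by (rule symmetric_mat_inner)
  fix x :: "real^'n" assume "x \<noteq> 0"
  show "0 < x \<bullet> (P *v x)"
  proof (rule ccontr)
    assume "\<not> 0 < x \<bullet> (P *v x)"
    then have 0: "x \<bullet> (P *v x) = 0" using P(1) by (auto simp: psd_def intro: antisym)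
    define y where "y = P *v x"
    define \<alpha> where "\<alpha> = y \<bullet> y"
    define \<beta> where "\<beta> = y \<bullet> (P *v y)"
    have "\<alpha> = x \<bullet> (Q *v x)"
      by (simp add: \<alpha>_def y_def P(2)[symmetric] matrix_vector_mul_assoc[symmetric] sym)
    then have "0 < \<alpha>" using Q \<open>x \<noteq> 0\<close> by (simp add: pd_def)
    have "0 \<le> \<beta>" using P(1) by (simp add: \<beta>_def psd_def)
    \<comment> \<open>Any positive s with s \<beta> < 2 \<alpha> would do; \<beta> + 1 covers the
      case \<beta> = 0.\<close>
    define s where "s = \<alpha> / (\<beta> + 1)"
    have "(x - s *\<^sub>R y) \<bullet> (P *v (x - s *\<^sub>R y)) = s * (s * \<beta> - 2 * \<alpha>)"
      using 0 sym[of x y]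
      by (simp add: matrix_vector_mult_diff_distrib matrix_vector_mult_scaleR inner_diff_left inner_diff_right
          y_def[symmetric] \<alpha>_def \<beta>_def algebra_simps)
    moreover have "s * (s * \<beta> - 2 * \<alpha>) < 0"
    proof (rule mult_pos_neg)
      show "0 < s" using \<open>0 < \<alpha>\<close> \<open>0 \<le> \<beta>\<close> by (simp add: s_def)
      have "s * \<beta> \<le> \<alpha>" using \<open>0 < \<alpha>\<close> \<open>0 \<le> \<beta>\<close> by (simp add: s_def field_simps)
      then show "s * \<beta> - 2 * \<alpha> < 0" using \<open>0 < \<alpha>\<close> by simp
    qed
    moreover have "0 \<le> (x - s *\<^sub>R y) \<bullet> (P *v (x - s *\<^sub>R y))" using P(1) by (simp add: psd_def)
    ultimately show False by simp
  qed
qed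

text \<open>The square root is \<open>\<epsilon>\<^sup>-\<^sup>1\<^sup>/\<^sup>2(I - Y)\<close>, where \<open>\<epsilon>Q = I - E\<close> with \<open>\<parallel>E\<parallel> < 1\<close> and \<open>Y\<close> is the
  fixed point of the contraction \<open>Y \<mapsto> (E + Y\<^sup>2)/2\<close>.\<close>
lemma psd_sqrt_exists:
  fixes Q :: "real^'n^'n"
  assumes "pd Q"
  shows "\<exists>P. psd P \<and> P ** P = Q"
proof -
  obtain q where q: "q > 0" "\<And>x. q * (norm x)\<^sup>2 \<le> x \<bullet> (Q *v x)"
    using pd_coercive[OF assms] by blast
  have symQ: "x \<bullet> (Q *v y) = (Q *v x) \<bullet> y" for x y
    using assms by (intro symmetric_mat_inner) (simp add: pd_def)
  define b where "b = norm Q + q"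
  have b: "0 < b" "q \<le> b" "norm Q \<le> b" using q(1) by (auto simp: b_def add_nonneg_pos)
  \<comment> \<open>\<epsilon> minimizes 1 - 2 \<epsilon> q + \<epsilon>^2 b^2, which bounds the
    squared operator norm of I - \<epsilon> Q; the minimum 1 - q^2 / b^2 becomes \<rho>^2.\<close>
  define \<epsilon> where "\<epsilon> = q / b\<^sup>2"
  have "0 < \<epsilon>" using q(1) b by (simp add: \<epsilon>_def)
  define \<rho> where "\<rho> = sqrt (1 - q\<^sup>2 / b\<^sup>2)"
  have "q\<^sup>2 / b\<^sup>2 \<le> 1" using b q(1) by (simp add: power_mono)
  then have \<rho>: "0 \<le> \<rho>" "\<rho> < 1" using q(1) b by (auto simp: \<rho>_def)
  have \<rho>2: "\<rho>\<^sup>2 = 1 - q\<^sup>2 / b\<^sup>2" using \<open>q\<^sup>2 / b\<^sup>2 \<le> 1\<close> by (simp add: \<rho>_def)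
  \<comment> \<open>Bounded operators replace matrices here because the bound below 1 concerns the
    operator norm; the Frobenius norm of I - \<epsilon> Q may exceed 1.\<close>
  define E where "E = id_blinfun - \<epsilon> *\<^sub>R Blinfun ((*v) Q)"
  have bQ: "blinfun_apply (Blinfun ((*v) Q)) = (*v) Q"
    by (intro bounded_linear_Blinfun_apply matrix_vector_mul_bounded_linear)
  have E: "blinfun_apply E x = x - \<epsilon> *\<^sub>R (Q *v x)" for x
    by (simp add: E_def blinfun.bilinear_simps bQ)
  have nE: "norm E \<le> \<rho>"
  proof (rule norm_blinfun_bound[OF \<rho>(1)])
    fix x :: "real^'n"
    have "(norm (blinfun_apply E x))\<^sup>2 = (norm x)\<^sup>2 - 2 * \<epsilon> * (x \<bullet> (Q *v x)) + \<epsilon>\<^sup>2 * (norm (Q *v x))\<^sup>2"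
      unfolding E power2_norm_eq_inner inner_diff_left inner_diff_right
      by (simp add: inner_commute power2_eq_square algebra_simps)
    also have "\<dots> \<le> (norm x)\<^sup>2 - 2 * \<epsilon> * (q * (norm x)\<^sup>2) + \<epsilon>\<^sup>2 * (b * norm x)\<^sup>2"
    proof -
      have "norm (Q *v x) \<le> b * norm x"
        using norm_matrix_vector_le[of Q x] mult_right_mono[OF b(3), of "norm x"] by simp
      then have "\<epsilon>\<^sup>2 * (norm (Q *v x))\<^sup>2 \<le> \<epsilon>\<^sup>2 * (b * norm x)\<^sup>2" by (intro mult_left_mono power_mono) auto
      moreover have "2 * \<epsilon> * (q * (norm x)\<^sup>2) \<le> 2 * \<epsilon> * (x \<bullet> (Q *v x))"
        using q(2) \<open>0 < \<epsilon>\<close> by (intro mult_left_mono) auto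
      ultimately show ?thesis by simp
    qed
    also have "\<dots> = (\<rho> * norm x)\<^sup>2"
      unfolding power_mult_distrib \<rho>2 using b(1) by (simp add: \<epsilon>_def field_simps power2_eq_square)
    finally show "norm (blinfun_apply E x) \<le> \<rho> * norm x"
      by (rule power2_le_imp_le) (use \<rho>(1) in simp)
  qed
  \<comment> \<open>Self-adjointness is built into the complete set, so the fixed point inherits
    it.\<close>
  define S where "S = {Y :: (real^'n) \<Rightarrow>\<^sub>L (real^'n). norm Y \<le> \<rho> \<and> (\<forall>x y. x \<bullet> blinfun_apply Y y = blinfun_apply Y x \<bullet> y)}"
  define f where "f Y = (1/2) *\<^sub>R (E + (Y o\<^sub>L Y))" for Y
  have "closed S"
  proof -
    have "S = cball 0 \<rho> \<inter> (\<Inter>x. \<Inter>y. {Y. x \<bullet> blinfun_apply Y y = blinfun_apply Y x \<bullet> y})"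
      by (auto simp: S_def)
    moreover have "closed {Y. x \<bullet> blinfun_apply Y y = blinfun_apply Y x \<bullet> y}" for x y :: "real^'n"
      by (intro closed_Collect_eq continuous_intros)
    ultimately show ?thesis by (auto intro!: closed_INT closed_Int)
  qed
  then have "complete S" by (simp add: complete_eq_closed)
  moreover have "S \<noteq> {}" using \<rho>(1) by (auto simp: S_def intro!: exI[of _ 0])
  moreover have "f ` S \<subseteq> S"
  proof (intro image_subsetI)
    fix Y assume Y: "Y \<in> S"
    then have nY: "norm Y \<le> \<rho>" and sY: "x \<bullet> blinfun_apply Y y = blinfun_apply Y x \<bullet> y" for x y
      by (auto simp: S_def)
    have "norm (Y o\<^sub>L Y) \<le> \<rho> * \<rho>"
      using norm_blinfun_compose[of Y Y] mult_mono[OF nY nY] \<rho>(1) by simp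
    also have "\<dots> \<le> \<rho>" using \<rho> by (simp add: mult_left_le)
    finally have "norm (E + (Y o\<^sub>L Y)) \<le> 2 * \<rho>"
      using norm_triangle_ineq[of E "Y o\<^sub>L Y"] nE by simp
    then have "norm (f Y) \<le> \<rho>" by (simp add: f_def)
    moreover have "x \<bullet> blinfun_apply (f Y) y = blinfun_apply (f Y) x \<bullet> y" for x y
      by (simp add: f_def blinfun.bilinear_simps E inner_add_right inner_add_left inner_diff_left inner_diff_right symQ sY)
    ultimately show "f Y \<in> S" by (simp add: S_def)
  qed
  moreover have "dist (f Y) (f Z) \<le> \<rho> * dist Y Z" if "Y \<in> S" "Z \<in> S" for Y Z
  proof -
    have "f Y - f Z = (1/2) *\<^sub>R ((Y o\<^sub>L (Y - Z)) + ((Y - Z) o\<^sub>L Z))"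
      by (simp add: f_def bounded_bilinear.diff_left[OF bounded_bilinear_blinfun_compose]
          bounded_bilinear.diff_right[OF bounded_bilinear_blinfun_compose] algebra_simps)
    moreover have "norm (Y o\<^sub>L (Y - Z)) \<le> \<rho> * norm (Y - Z)" "norm ((Y - Z) o\<^sub>L Z) \<le> norm (Y - Z) * \<rho>"
      using that \<rho>(1) by (auto simp: S_def intro!: order_trans[OF norm_blinfun_compose] mult_mono)
    ultimately have "norm (f Y - f Z) \<le> \<rho> * norm (Y - Z)"
      using norm_triangle_ineq[of "Y o\<^sub>L (Y - Z)" "(Y - Z) o\<^sub>L Z"] by (simp add: mult.commute[of _ \<rho>])
    then show ?thesis by (simp add: dist_norm)
  qed
  ultimately obtain Y where Y: "Y \<in> S" "f Y = Y"
    using Banach_fix[of S \<rho> f] \<rho> by blast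
  define Z where "Z x = (1 / sqrt \<epsilon>) *\<^sub>R (x - blinfun_apply Y x)" for x
  have linZ: "linear Z"
    by (rule linearI) (simp_all add: Z_def blinfun.bilinear_simps algebra_simps)
  define P where "P = matrix Z"
  have P: "P *v x = Z x" for x unfolding P_def using linZ by (simp add: matrix_works)
  have sZ: "x \<bullet> Z y = Z x \<bullet> y" for x y
    using Y(1) by (simp add: Z_def S_def inner_diff_left inner_diff_right)
  have "P ** P = Q"
  proof -
    have "P ** P *v x = Q *v x" for x
    proof -
      have "2 *\<^sub>R blinfun_apply (f Y) x = (x - \<epsilon> *\<^sub>R (Q *v x)) + blinfun_apply Y (blinfun_apply Y x)"
        by (simp add: f_def blinfun.scaleR_left blinfun.add_left E)
      then have "2 *\<^sub>R blinfun_apply Y x = (x - \<epsilon> *\<^sub>R (Q *v x)) + blinfun_apply Y (blinfun_apply Y x)"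
        unfolding Y(2) .
      then have "x - blinfun_apply Y x - blinfun_apply Y (x - blinfun_apply Y x) = \<epsilon> *\<^sub>R (Q *v x)"
        by (simp add: blinfun.bilinear_simps scaleR_2 algebra_simps)
      then have "(1 / \<epsilon>) *\<^sub>R (x - blinfun_apply Y x - blinfun_apply Y (x - blinfun_apply Y x)) = Q *v x"
        using \<open>0 < \<epsilon>\<close> by simp
      moreover have "Z (Z x) = (1 / sqrt \<epsilon> * (1 / sqrt \<epsilon>)) *\<^sub>R (x - blinfun_apply Y x - blinfun_apply Y (x - blinfun_apply Y x))"
        unfolding Z_def blinfun.scaleR_right scaleR_diff_right[symmetric] scaleR_scaleR ..
      ultimately show ?thesis
        using \<open>0 < \<epsilon>\<close> by (simp add: matrix_vector_mul_assoc[symmetric] P)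
    qed
    then show ?thesis by (simp add: matrix_eq)
  qed
  moreover have "psd P"
    unfolding psd_def
  proof (intro conjI allI)
    have "transpose P *v x = P *v x" for x
    proof (rule vector_eq_rdot[THEN iffD1], rule allI)
      show "(transpose P *v x) \<bullet> y = (P *v x) \<bullet> y" for y
        by (metis P inner_matrix_mult_transpose sZ)
    qed
    then show "symmetric_mat P" unfolding symmetric_mat_def matrix_eq by blast
    fix x
    have "x \<bullet> blinfun_apply Y x \<le> norm x * norm (blinfun_apply Y x)" by (rule norm_cauchy_schwarz)
    also have "\<dots> \<le> norm x * (\<rho> * norm x)"
      using norm_blinfun[of Y x] mult_right_mono[of "norm Y" \<rho> "norm x"] Y(1)
      by (intro mult_left_mono) (auto simp: S_def)
    also have "\<dots> \<le> x \<bullet> x"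
      using \<rho> mult_right_mono[of \<rho> 1 "(norm x)\<^sup>2"] by (simp add: power2_norm_eq_inner[symmetric] power2_eq_square mult_ac)
    finally show "0 \<le> x \<bullet> (P *v x)"
      using \<open>0 < \<epsilon>\<close> by (simp add: P Z_def inner_diff_right)
  qed
  ultimately show ?thesis by blast
qed

section \<open>The H-infinity constraint\<close>

text \<open>Equality of the squares is a homogeneous Sylvester equation for P - P' whose
  coefficients -P and -P' are Hurwitz.\<close>

lemma psd_sqrt_unique:
  fixes P P' Q :: "real^'n^'n"
  assumes "psd P" "P ** P = Q" "psd P'" "P' ** P' = Q" "pd Q"
  shows "P = P'"
proof -
  have pd: "pd P" "pd P'" using assms psd_sqrt_pd by blast+
  have "(- P) ** (P - P') + (P - P') ** transpose (- P') = 0"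
  proof -
    have "transpose (- P') = - P'"
      using pd(2) by (auto simp: pd_def symmetric_mat_def transpose_def vec_eq_iff)
    moreover have "(- P) ** (P - P') + (P - P') ** (- P') = P' ** P' - P ** P"
      by (simp add: matrix_mult.diff_left matrix_mult.diff_right matrix_mult.minus_left matrix_mult.minus_right)
    ultimately show ?thesis using assms(2,4) by simp
  qed
  then have "P - P' = 0" by (rule sylvester_unique[OF pd_hurwitz_minus[OF pd(1)] pd_hurwitz_minus[OF pd(2)]])
  then show ?thesis by simp
qed

lemma psd_sqrt_square:
  assumes "pd Q"
  shows "psd_sqrt Q ** psd_sqrt Q = Q" and "symmetric_mat (psd_sqrt Q)"
proof -
  have "\<exists>!P. psd P \<and> P ** P = Q"
    using psd_sqrt_exists[OF assms] psd_sqrt_unique[OF _ _ _ _ assms] by blast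
  from theI'[OF this] have "psd (psd_sqrt Q) \<and> psd_sqrt Q ** psd_sqrt Q = Q"
    unfolding psd_sqrt_def .
  then show "psd_sqrt Q ** psd_sqrt Q = Q" "symmetric_mat (psd_sqrt Q)" by (auto simp: psd_def)
qed

lemma norm_psd_sqrt_mult:
  fixes Q :: "real^'n^'n"
  assumes "pd Q"
  shows "(norm (psd_sqrt Q *v x))\<^sup>2 = x \<bullet> (Q *v x)"
  using symmetric_mat_inner[OF psd_sqrt_square(2)[OF assms], of x "psd_sqrt Q *v x"] psd_sqrt_square(1)[OF assms]
  by (simp add: power2_norm_eq_inner matrix_vector_mul_assoc)

section \<open>The state weight and frequency-uniform resolvent estimates\<close>

lemma inner_S_mat:
  fixes K :: "real^'n^'m"
  shows "x \<bullet> (S_mat Qi Ri K *v y) = x \<bullet> (Qi *v y) + (K *v x) \<bullet> (Ri *v (K *v y))"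
proof -
  have "S_mat Qi Ri K *v y = Qi *v y + transpose K *v (Ri *v (K *v y))"
    by (simp add: S_mat_def matrix_vector_mult_add_rdistrib matrix_vector_mul_assoc matrix_mul_assoc del: transpose_matrix_vector)
  then show ?thesis
    using inner_matrix_mult_transpose[of x "transpose K" "Ri *v (K *v y)"]
    by (simp add: inner_add_right del: transpose_matrix_vector)
qed

lemma symmetric_S_mat:
  assumes "symmetric_mat Qi" "symmetric_mat Ri"
  shows "symmetric_mat (S_mat Qi Ri K)"
proof -
  have "transpose (S_mat Qi Ri K) = transpose Qi + transpose (transpose K ** Ri ** K)"
    by (simp add: S_mat_def transpose_def vec_eq_iff)
  then show ?thesis
    using assms by (simp add: symmetric_mat_def S_mat_def matrix_transpose_mul matrix_mul_assoc)
qed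

text \<open>The inverse of the resolvent on the imaginary axis. For Hurwitz A, the state driven by w
  is the x that this map sends to w, and estimates use this equation in place of
  \<open>matrix_inv\<close>.\<close>

definition resolvent_eq :: "real^'n^'n \<Rightarrow> real \<Rightarrow> complex^'n \<Rightarrow> complex^'n" where
  "resolvent_eq A \<omega> x = (\<i> * complex_of_real \<omega>) *s x - cmat A *v x"

lemma resolvent_eq_matrix: "(mat (\<i> * complex_of_real \<omega>) - cmat A) *v x = resolvent_eq A \<omega> x"
  by (simp add: resolvent_eq_def matrix_vector_mult_diff_rdistrib mat_mult_vec)

lemma cmat_scaleR: "cmat M *v (c *\<^sub>R v) = c *\<^sub>R (cmat M *v v)"
  by (simp add: matrix_vector_mult_def vec_eq_iff scaleR_sum_right)

text \<open>The frequency axis is not compact. Beyond \<open>norm A + 1\<close> the term i \<omega>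
  x dominates and leaves at least 1 on unit vectors; the other frequencies times the unit sphere
  form a compact set, where a zero minimum would be an eigenvalue on the imaginary axis.\<close>

lemma resolvent_bound:
  fixes A :: "real^'n^'n"
  assumes "hurwitz A"
  shows "\<exists>c>0. \<forall>\<omega> x. norm x \<le> c * norm (resolvent_eq A \<omega> x)"
proof -
  let ?g = "\<lambda>p. norm (resolvent_eq A (fst p) (snd p))"
  let ?C = "{- (norm A + 1)..norm A + 1} \<times> (sphere 0 1 :: (complex^'n) set)"
  obtain v0 :: "complex^'n" where "norm v0 = 1" using vector_choose_size[of 1] by auto
  moreover have "- 1 \<le> norm A" by (rule order_trans[OF _ norm_ge_zero]) simp
  ultimately have "(0, v0) \<in> ?C" by auto
  then have ne: "?C \<noteq> {}" by blast
  have comp: "compact ?C" by (intro compact_Times compact_Icc compact_sphere)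
  have bl1: "bounded_linear (\<lambda>x. \<i> *s (x::complex^'n))"
    by (rule bounded_linear_intro[of _ 1])
       (simp_all add: norm_scale vector_add_ldistrib vec_eq_iff scaleR_conv_of_real[where 'a = complex])
  have bl2: "bounded_linear (\<lambda>x. cmat A *v x)"
    by (rule bounded_linear_intro[of _ "norm A"])
       (simp_all add: matrix_vector_right_distrib cmat_scaleR norm_cmat_mult_le mult.commute[of _ "norm A"])
  have "resolvent_eq A \<omega> x = \<omega> *\<^sub>R (\<i> *s x) - cmat A *v x" for \<omega> x
    by (simp add: resolvent_eq_def vec_eq_iff scaleR_conv_of_real[where 'a = complex] mult_ac)
  then have "continuous_on ?C ?g"
    by (auto intro!: continuous_intros bounded_linear.continuous_on[OF bl1] bounded_linear.continuous_on[OF bl2])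
  from continuous_attains_inf[OF comp ne this] obtain p where
    p: "p \<in> ?C" "\<And>q. q \<in> ?C \<Longrightarrow> ?g p \<le> ?g q" by blast
  define m where "m = min 1 (?g p)"
  have pos: "0 < ?g p"
  proof (rule ccontr)
    assume "\<not> 0 < ?g p"
    then have "cmat A *v snd p = (\<i> * complex_of_real (fst p)) *s snd p" by (simp add: resolvent_eq_def)
    moreover have "snd p \<noteq> 0" using p(1) by (cases p) auto
    ultimately have "Re (\<i> * complex_of_real (fst p)) < 0" using assms unfolding hurwitz_def by blast
    then show False by simp
  qed
  have unit: "m \<le> norm (resolvent_eq A \<omega> x)" if "norm x = 1" for \<omega> x
  proof (cases "\<bar>\<omega>\<bar> \<le> norm A + 1")
    case True
    then have "(\<omega>, x) \<in> ?C" using that by (auto simp: abs_le_iff)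
    from p(2)[OF this] show ?thesis by (simp add: m_def)
  next
    case False
    have "norm ((\<i> * complex_of_real \<omega>) *s x) - norm (cmat A *v x) \<le> norm (resolvent_eq A \<omega> x)"
      unfolding resolvent_eq_def by (rule norm_triangle_ineq2)
    moreover have "norm ((\<i> * complex_of_real \<omega>) *s x) = \<bar>\<omega>\<bar>" using that by (simp add: norm_scale norm_mult)
    moreover have "norm (cmat A *v x) \<le> norm A" using norm_cmat_mult_le[of A x] that by simp
    ultimately show ?thesis using False by (simp add: m_def)
  qed
  have "norm x \<le> (1 / m) * norm (resolvent_eq A \<omega> x)" for \<omega> x
  proof (cases "x = 0")
    case False
    have "resolvent_eq A \<omega> (x /\<^sub>R norm x) = resolvent_eq A \<omega> x /\<^sub>R norm x"
      by (simp add: resolvent_eq_def cmat_scaleR scaleR_diff_right vec_eq_iff scaleR_conv_of_real[where 'a = complex] mult_ac)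
    then have "m \<le> norm (resolvent_eq A \<omega> x) / norm x"
      using unit[of "x /\<^sub>R norm x" \<omega>] False by (simp add: divide_inverse mult.commute)
    then show ?thesis using False pos by (simp add: field_simps m_def)
  qed (use pos in \<open>simp add: m_def\<close>)
  moreover have "0 < 1 / m" using pos by (simp add: m_def)
  ultimately show ?thesis by blast
qed

lemma resolvent_eq_matrix_inv:
  assumes "hurwitz A"
  shows "resolvent_eq A \<omega> (matrix_inv (mat (\<i> * complex_of_real \<omega>) - cmat A) *v w) = w"
    and "matrix_inv (mat (\<i> * complex_of_real \<omega>) - cmat A) *v resolvent_eq A \<omega> x = x"
proof -
  let ?M = "mat (\<i> * complex_of_real \<omega>) - cmat A"
  have "\<not> eigenvalue_of A (\<i> * complex_of_real \<omega>)"
    using assms by (auto simp: hurwitz_iff_eigenvalue)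
  then have "invertible ?M" by (simp add: eigenvalue_of_iff_det invertible_det_nz)
  then have "?M ** matrix_inv ?M = mat 1 \<and> matrix_inv ?M ** ?M = mat 1"
    unfolding invertible_def matrix_inv_def by (rule someI_ex)
  then show "resolvent_eq A \<omega> (matrix_inv ?M *v w) = w" "matrix_inv ?M *v resolvent_eq A \<omega> x = x"
    by (simp_all add: resolvent_eq_matrix[symmetric] matrix_vector_mul_assoc)
qed

section \<open>The transfer matrix, its gain and the openness of the constraint set\<close>

lemma T_inf_apply:
  assumes "hurwitz (A + B ** K)" and x: "resolvent_eq (A + B ** K) \<omega> x = cmat Bw *v w"
  shows "T_inf Qi Ri A B Bw K \<omega> w = (cmat (psd_sqrt Qi) *v x, cmat (psd_sqrt Ri ** K) *v x)"
  unfolding T_inf_def Let_def x[symmetric] resolvent_eq_matrix_inv(2)[OF assms(1)] ..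

lemma resolvent_eq_solvable:
  assumes "hurwitz A" obtains x where "resolvent_eq A \<omega> x = w"
  using resolvent_eq_matrix_inv(1)[OF assms] by blast

lemma bounded_linear_T_inf: "bounded_linear (T_inf Qi Ri A B Bw K \<omega>)"
proof -
  have bl: "bounded_linear (\<lambda>x. M *v x)" for M :: "complex^'x^'y"
  proof -
    have "linear (\<lambda>x. M *v x)"
    proof (rule linearI)
      show "M *v (c *\<^sub>R x) = c *\<^sub>R (M *v x)" for c x
        by (simp add: matrix_vector_mult_def vec_eq_iff scaleR_sum_right)
    qed (rule matrix_vector_right_distrib)
    then show ?thesis by (simp add: linear_linear)
  qed
  show ?thesis
    unfolding T_inf_def Let_def
    by (intro bounded_linear_Pair bounded_linear_compose[OF bl] bl)
qed

lemma norm_Pair_le: "norm (a, b) \<le> norm a + norm b"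
  unfolding norm_Pair by (rule sqrt_sum_squares_le_sum) auto

text \<open>An upper bound of the H-infinity norm, stated frequency by frequency; unlike
  \<open>SUP\<close> it makes sense before boundedness is known.\<close>

definition gain_le where
  "gain_le Qi Ri A B Bw K g \<longleftrightarrow> (\<forall>\<omega> w. norm (T_inf Qi Ri A B Bw K \<omega> w) \<le> g * norm w)"

lemma gain_le_exists:
  assumes "hurwitz (A + B ** K)"
  shows "\<exists>g. gain_le Qi Ri A B Bw K g"
proof -
  obtain c where c: "0 < c" "\<And>\<omega> x. norm x \<le> c * norm (resolvent_eq (A + B ** K) \<omega> x)"
    using resolvent_bound[OF assms] by blast
  have "norm (T_inf Qi Ri A B Bw K \<omega> w) \<le> ((norm (psd_sqrt Qi) + norm (psd_sqrt Ri ** K)) * (c * norm Bw)) * norm w" for \<omega> w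
  proof -
    obtain x where x: "resolvent_eq (A + B ** K) \<omega> x = cmat Bw *v w"
      using resolvent_eq_solvable[OF assms] .
    have "norm x \<le> c * (norm Bw * norm w)"
      using c(2)[of x \<omega>] mult_left_mono[OF norm_cmat_mult_le[of Bw w] less_imp_le[OF c(1)]] unfolding x
      by (rule order_trans)
    then have "(norm (psd_sqrt Qi) + norm (psd_sqrt Ri ** K)) * norm x \<le> (norm (psd_sqrt Qi) + norm (psd_sqrt Ri ** K)) * (c * (norm Bw * norm w))"
      by (intro mult_left_mono) auto
    moreover have "norm (T_inf Qi Ri A B Bw K \<omega> w) \<le> (norm (psd_sqrt Qi) + norm (psd_sqrt Ri ** K)) * norm x"
      unfolding T_inf_apply[OF assms x] distrib_right
      by (intro order_trans[OF norm_Pair_le] add_mono norm_cmat_mult_le)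
    ultimately show ?thesis by (simp add: mult_ac)
  qed
  then show ?thesis unfolding gain_le_def by blast
qed

text \<open>A \<open>SUP\<close> of reals bounds its members only if they are bounded above;
  \<open>gain_le_exists\<close> supplies this, and the norm itself is then the gain g.\<close>

lemma Kbeta_iff:
  assumes "0 < \<beta>"
  shows "K \<in> Kbeta Qi Ri A B Bw \<beta> \<longleftrightarrow>
     hurwitz (A + B ** K) \<and> (\<exists>g\<ge>0. g < \<beta> \<and> gain_le Qi Ri A B Bw K g)"
proof (intro iffI conjI)
  let ?o = "\<lambda>\<omega>. onorm (T_inf Qi Ri A B Bw K \<omega>)"
  assume K: "K \<in> Kbeta Qi Ri A B Bw \<beta>"
  then show h: "hurwitz (A + B ** K)" by (simp add: Kbeta_def)
  obtain g where "gain_le Qi Ri A B Bw K g" using gain_le_exists[OF h] by blast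
  then have "norm (T_inf Qi Ri A B Bw K \<omega> w) \<le> max g 0 * norm w" for \<omega> w
    unfolding gain_le_def using mult_right_mono[of g "max g 0" "norm w"] by (meson max.cobounded1 norm_ge_zero order_trans)
  then have "?o \<omega> \<le> max g 0" for \<omega> by (intro onorm_bound) auto
  then have bdd: "bdd_above (range ?o)" by (intro bdd_aboveI) auto
  have le: "?o \<omega> \<le> hinf_norm Qi Ri A B Bw K" for \<omega>
    unfolding hinf_norm_def using bdd by (intro cSUP_upper) auto
  have "norm (T_inf Qi Ri A B Bw K \<omega> w) \<le> hinf_norm Qi Ri A B Bw K * norm w" for \<omega> w
    using onorm[OF bounded_linear_T_inf] mult_right_mono[OF le norm_ge_zero] by (rule order_trans)
  moreover have "0 \<le> hinf_norm Qi Ri A B Bw K"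
    using onorm_pos_le[OF bounded_linear_T_inf] le[of 0] by (rule order_trans)
  moreover have "hinf_norm Qi Ri A B Bw K < \<beta>" using K by (simp add: Kbeta_def)
  ultimately show "\<exists>g\<ge>0. g < \<beta> \<and> gain_le Qi Ri A B Bw K g" unfolding gain_le_def by blast
next
  assume a: "hurwitz (A + B ** K) \<and> (\<exists>g\<ge>0. g < \<beta> \<and> gain_le Qi Ri A B Bw K g)"
  then obtain g where g: "0 \<le> g" "g < \<beta>" "gain_le Qi Ri A B Bw K g" by blast
  then have "onorm (T_inf Qi Ri A B Bw K \<omega>) \<le> g" for \<omega>
    unfolding gain_le_def by (intro onorm_bound) auto
  then have "hinf_norm Qi Ri A B Bw K \<le> g" unfolding hinf_norm_def by (intro cSUP_least) auto
  with a g(2) show "K \<in> Kbeta Qi Ri A B Bw \<beta>" by (simp add: Kbeta_def)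
qed

text \<open>For one input, let x and y be the states at K and K0. The map
  \<open>resolvent_eq\<close> at K0 sends x - y to B (K - K0) x, so the bound c at K0 controls the
  difference at all frequencies.\<close>

lemma gain_le_perturb:
  fixes K0 :: "real^'n^'m"
  assumes h: "hurwitz (A + B ** K0)" and g: "gain_le Qi Ri A B Bw K0 g" and "0 < e"
  shows "\<exists>d>0. \<forall>K. norm (K - K0) < d \<longrightarrow> hurwitz (A + B ** K) \<longrightarrow> gain_le Qi Ri A B Bw K (g + e)"
proof -
  obtain c where c: "0 < c" "\<And>\<omega> x. norm x \<le> c * norm (resolvent_eq (A + B ** K0) \<omega> x)"
    using resolvent_bound[OF h] by blast
  let ?P = "psd_sqrt Qi" and ?R = "psd_sqrt Ri"
  \<comment> \<open>A Lipschitz constant of the output: c \<open>norm B\<close> accounts for the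
    change of the state, \<open>norm ?R\<close> for the change of the output matrix, and 2 c
    \<open>norm Bw\<close> bounds the state x by the input.\<close>
  define \<kappa> where "\<kappa> = ((norm ?P + norm (?R ** K0)) * (c * norm B) + norm ?R) * (2 * c * norm Bw)"
  have "0 \<le> \<kappa>" using c(1) by (simp add: \<kappa>_def)
  \<comment> \<open>The second term yields c |B (K - K0)| <= 1/2, so the perturbation is absorbed
    when x is bounded; the first keeps the output change below e |w|.\<close>
  define d where "d = min (e / (\<kappa> + 1)) (1 / (2 * c * (norm B + 1)))"
  have nB: "0 < norm B + 1" using norm_ge_zero[of B] by linarith
  have "0 < d" using \<open>0 \<le> \<kappa>\<close> \<open>0 < e\<close> c(1) nB by (simp add: d_def)
  moreover have "gain_le Qi Ri A B Bw K (g + e)" if K: "norm (K - K0) < d" and hK: "hurwitz (A + B ** K)" for K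
    unfolding gain_le_def
  proof (intro allI)
    fix \<omega> w
    let ?\<eta> = "norm (K - K0)" and ?\<delta> = "B ** (K - K0)"
    have \<delta>: "norm ?\<delta> \<le> norm B * ?\<eta>" by (rule norm_matrix_mult_le)
    have d1: "c * norm ?\<delta> \<le> 1/2"
    proof -
      have "c * norm ?\<delta> \<le> c * ((norm B + 1) * d)"
        using \<delta> K c(1) nB mult_mono[of "norm B" "norm B + 1" ?\<eta> d] by (intro mult_left_mono) auto
      also have "\<dots> \<le> c * ((norm B + 1) * (1 / (2 * c * (norm B + 1))))"
        using c(1) nB by (intro mult_left_mono) (auto simp: d_def)
      also have "\<dots> = 1/2"
        using c(1) nB by (simp only: times_divide_eq_right mult_1_right mult.assoc mult.left_commute[of 2] divide_eq_eq) auto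
      finally show ?thesis .
    qed
    have d2: "\<kappa> * ?\<eta> \<le> e"
    proof -
      have "\<kappa> * ?\<eta> \<le> (\<kappa> + 1) * (e / (\<kappa> + 1))"
        using K \<open>0 \<le> \<kappa>\<close> by (intro mult_mono) (auto simp: d_def)
      then show ?thesis using \<open>0 \<le> \<kappa>\<close> by simp
    qed
    obtain x where x: "resolvent_eq (A + B ** K) \<omega> x = cmat Bw *v w"
      using resolvent_eq_solvable[OF hK] .
    obtain y where y: "resolvent_eq (A + B ** K0) \<omega> y = cmat Bw *v w"
      using resolvent_eq_solvable[OF h] .
    have split: "resolvent_eq (A + B ** K0) \<omega> z = resolvent_eq (A + B ** K) \<omega> z + cmat ?\<delta> *v z" for z
    proof -
      have "cmat (A + B ** K) = cmat (A + B ** K0) + cmat ?\<delta>"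
        by (simp add: matrix_mult.diff_right cmat_def vec_eq_iff)
      then show ?thesis by (simp add: resolvent_eq_def matrix_vector_mult_add_rdistrib)
    qed
    have "resolvent_eq (A + B ** K0) \<omega> (x - y) = cmat ?\<delta> *v x"
    proof -
      have "resolvent_eq (A + B ** K0) \<omega> (x - y) = resolvent_eq (A + B ** K0) \<omega> x - resolvent_eq (A + B ** K0) \<omega> y"
        by (simp add: resolvent_eq_matrix[symmetric] matrix_vector_mult_diff_distrib)
      then show ?thesis by (simp add: split[of x] x y)
    qed
    then have xy: "norm (x - y) \<le> c * (norm ?\<delta> * norm x)"
      using order_trans[OF c(2)[of "x - y" \<omega>]] mult_left_mono[OF norm_cmat_mult_le[of ?\<delta> x] less_imp_le[OF c(1)]]
      by simp
    have nx: "norm x \<le> 2 * c * norm Bw * norm w"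
    proof -
      have "norm x \<le> c * norm (cmat Bw *v w + cmat ?\<delta> *v x)"
        using c(2)[of x \<omega>] unfolding split[of x] x .
      also have "\<dots> \<le> c * (norm Bw * norm w + norm ?\<delta> * norm x)"
        using c(1) by (intro mult_left_mono norm_triangle_le add_mono norm_cmat_mult_le) auto
      also have "\<dots> \<le> c * norm Bw * norm w + 1/2 * norm x"
        using mult_right_mono[OF d1, of "norm x"] by (simp add: algebra_simps)
      finally show ?thesis by simp
    qed
    define u where "u = cmat ?P *v (x - y)"
    define v where "v = cmat (?R ** K0) *v (x - y) + cmat (?R ** (K - K0)) *v x"
    have "T_inf Qi Ri A B Bw K \<omega> w = T_inf Qi Ri A B Bw K0 \<omega> w + (u, v)"
    proof -
      have "cmat (?R ** K) = cmat (?R ** K0) + cmat (?R ** (K - K0))"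
        by (simp add: matrix_mult.diff_right cmat_def vec_eq_iff)
      then show ?thesis
        by (simp add: T_inf_apply[OF hK x] T_inf_apply[OF h y] u_def v_def matrix_vector_mult_diff_distrib
            matrix_vector_mult_add_rdistrib)
    qed
    moreover have "norm (u, v) \<le> e * norm w"
    proof -
      have "norm (u, v) \<le> norm ?P * norm (x - y) + (norm (?R ** K0) * norm (x - y) + norm (?R ** (K - K0)) * norm x)"
        unfolding u_def v_def
        by (intro order_trans[OF norm_Pair_le] add_mono order_trans[OF norm_triangle_ineq] norm_cmat_mult_le)
      also have "\<dots> = (norm ?P + norm (?R ** K0)) * norm (x - y) + norm (?R ** (K - K0)) * norm x"
        by (simp add: algebra_simps)
      also have "\<dots> \<le> (norm ?P + norm (?R ** K0)) * (c * (norm B * ?\<eta> * norm x)) + norm ?R * ?\<eta> * norm x"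
      proof (intro add_mono mult_left_mono mult_right_mono)
        show "norm (x - y) \<le> c * (norm B * ?\<eta> * norm x)"
          using xy \<delta> c(1) by (intro order_trans[OF xy] mult_left_mono mult_right_mono) auto
      qed (auto intro: norm_matrix_mult_le)
      also have "\<dots> = ((norm ?P + norm (?R ** K0)) * (c * norm B) + norm ?R) * ?\<eta> * norm x"
        by (simp add: algebra_simps)
      also have "\<dots> \<le> ((norm ?P + norm (?R ** K0)) * (c * norm B) + norm ?R) * ?\<eta> * (2 * c * norm Bw * norm w)"
        using nx c(1) by (intro mult_left_mono) auto
      also have "\<dots> = \<kappa> * ?\<eta> * norm w"
        by (simp add: \<kappa>_def)
      also have "\<dots> \<le> e * norm w" using d2 by (intro mult_right_mono) auto
      finally show ?thesis .
    qed
    ultimately show "norm (T_inf Qi Ri A B Bw K \<omega> w) \<le> (g + e) * norm w"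
      using g norm_triangle_ineq[of "T_inf Qi Ri A B Bw K0 \<omega> w" "(u, v)"]
      unfolding gain_le_def distrib_right by (smt (verit))
  qed
  ultimately show ?thesis by blast
qed

lemma open_hurwitz_feedback: "open {K. hurwitz (A + B ** K)}"
proof -
  have "continuous_on UNIV (\<lambda>K. A + B ** K)"
    by (intro continuous_intros linear_continuous_on matrix_mult.bounded_linear_right)
  then have "open ((\<lambda>K. A + B ** K) -` {M. hurwitz M})"
    by (rule open_vimage[OF hurwitz_open])
  then show ?thesis by (simp add: vimage_def)
qed

text \<open>Half of the gap between g and \<beta> is spent on the perturbation of the gain. Openness
  is part of the claim, since analyticity asks for balls inside the set.\<close>

lemma open_Kbeta:
  assumes "0 < \<beta>"
  shows "open (Kbeta Qi Ri A B Bw \<beta>)"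
  unfolding open_dist
proof
  fix K0 assume "K0 \<in> Kbeta Qi Ri A B Bw \<beta>"
  then obtain g where h: "hurwitz (A + B ** K0)" and g: "0 \<le> g" "g < \<beta>" "gain_le Qi Ri A B Bw K0 g"
    unfolding Kbeta_iff[OF assms] by blast
  define e where "e = (\<beta> - g) / 2"
  have e: "0 < e" "g + e < \<beta>" using g(2) by (auto simp: e_def field_simps)
  obtain d1 where d1: "0 < d1" "\<And>K. norm (K - K0) < d1 \<Longrightarrow> hurwitz (A + B ** K) \<Longrightarrow> gain_le Qi Ri A B Bw K (g + e)"
    using gain_le_perturb[OF h g(3) e(1)] by blast
  obtain d2 where d2: "0 < d2" "\<And>K. dist K K0 < d2 \<Longrightarrow> hurwitz (A + B ** K)"
    using open_hurwitz_feedback[of A B] h unfolding open_dist by blast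
  have "K \<in> Kbeta Qi Ri A B Bw \<beta>" if "dist K K0 < min d1 d2" for K
    unfolding Kbeta_iff[OF assms] using that d1(2)[of K] d2(2)[of K] g(1) e by (auto simp: dist_norm intro!: exI[of _ "g + e"])
  moreover have "0 < min d1 d2" using d1(1) d2(1) by simp
  ultimately show "\<exists>d>0. \<forall>K. dist K K0 < d \<longrightarrow> K \<in> Kbeta Qi Ri A B Bw \<beta>" by blast
qed

section \<open>Stabilizing solutions of the Riccati equation\<close>

text \<open>The predicate under the description \<open>X_sol\<close>, with t for \<beta>^-2 and W
  for Bw Bw^T.\<close>

definition stabilizing :: "real \<Rightarrow> real^'n^'n \<Rightarrow> real^'n^'n \<Rightarrow> real^'n^'n \<Rightarrow> real^'n^'n \<Rightarrow> bool" where
  "stabilizing t S A W X \<longleftrightarrow> symmetric_mat X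
     \<and> A ** X + X ** transpose A + t *\<^sub>R (X ** S ** X) + W = 0 \<and> hurwitz (A + t *\<^sub>R (X ** S))"

lemma transpose_add: "transpose (M + N) = transpose M + transpose N"
  by (simp add: transpose_def vec_eq_iff)

lemma transpose_closed_loop:
  assumes "symmetric_mat X" "symmetric_mat S"
  shows "transpose (A + t *\<^sub>R (X ** S)) = transpose A + t *\<^sub>R (S ** X)"
  using assms by (simp add: transpose_add transpose_scalar matrix_transpose_mul symmetric_mat_def)

text \<open>With the closed loop of X on the left and that of Y on the right, the mixed terms t X S
  Y cancel, and X - Y solves a homogeneous Sylvester equation with Hurwitz coefficients.\<close>

lemma stabilizing_unique:
  assumes X: "stabilizing t S A W X" and Y: "stabilizing t S A W Y" and S: "symmetric_mat S"
  shows "X = Y"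
proof -
  let ?D = "X - Y"
  have tr: "transpose (A + t *\<^sub>R (Y ** S)) = transpose A + t *\<^sub>R (S ** Y)"
    using Y S by (intro transpose_closed_loop) (auto simp: stabilizing_def)
  have "(A + t *\<^sub>R (X ** S)) ** ?D + ?D ** transpose (A + t *\<^sub>R (Y ** S))
      = (A ** X + X ** transpose A + t *\<^sub>R (X ** S ** X) + W) - (A ** Y + Y ** transpose A + t *\<^sub>R (Y ** S ** Y) + W)"
    unfolding tr
    by (simp add: matrix_mult.add_left matrix_mult.add_right matrix_mult.diff_left matrix_mult.diff_right
        matrix_mult.scaleR_left matrix_mult.scaleR_right matrix_mul_assoc scaleR_diff_right)
  also have "\<dots> = 0" using X Y by (simp add: stabilizing_def)
  finally have "?D = 0"
    by (rule sylvester_unique[rotated 2]) (use X Y in \<open>auto simp: stabilizing_def\<close>)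
  then show ?thesis by simp
qed

lemma riccati_vec:
  fixes A X S Bw :: "real^'n^'n"
  assumes "A ** X + X ** transpose A + t *\<^sub>R (X ** S ** X) + Bw ** transpose Bw = 0"
  shows "A *v (X *v y) + X *v (transpose A *v y) + t *\<^sub>R (X *v (S *v (X *v y))) + Bw *v (transpose Bw *v y) = 0"
proof -
  have "(A ** X + X ** transpose A + t *\<^sub>R (X ** S ** X) + Bw ** transpose Bw) *v y = 0"
    using assms by simp
  then show ?thesis
    by (simp add: matrix_vector_mult_add_rdistrib scaleR_matrix_vector_assoc[symmetric] matrix_vector_mul_assoc[symmetric]
        del: transpose_matrix_vector)
qed

lemma riccati_quadratic:
  fixes A X S Bw :: "real^'n^'n"
  assumes "A ** X + X ** transpose A + t *\<^sub>R (X ** S ** X) + Bw ** transpose Bw = 0" and X: "symmetric_mat X"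
  shows "2 * ((X *v y) \<bullet> (transpose A *v y)) + t * ((X *v y) \<bullet> (S *v (X *v y))) + (norm (transpose Bw *v y))\<^sup>2 = 0"
proof -
  have "y \<bullet> (A *v (X *v y) + X *v (transpose A *v y) + t *\<^sub>R (X *v (S *v (X *v y))) + Bw *v (transpose Bw *v y)) = 0"
    by (simp only: riccati_vec[OF assms(1)] inner_zero_right)
  moreover have "y \<bullet> (A *v (X *v y)) = (X *v y) \<bullet> (transpose A *v y)"
    by (simp only: inner_matrix_mult_transpose[of y A] inner_commute)
  moreover have "y \<bullet> (Bw *v (transpose Bw *v y)) = (norm (transpose Bw *v y))\<^sup>2"
    by (simp only: inner_matrix_mult_transpose[of y Bw] power2_norm_eq_inner)
  ultimately show ?thesis
    by (simp add: inner_add_right symmetric_mat_inner[OF X] del: transpose_matrix_vector)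
qed

text \<open>The quadratic term dominates because \<open>S\<close> is coercive.\<close>
lemma riccati_bound:
  fixes A X S Bw :: "real^'n^'n"
  assumes eq: "A ** X + X ** transpose A + t *\<^sub>R (X ** S ** X) + Bw ** transpose Bw = 0" and X: "symmetric_mat X"
    and S: "\<And>x. q * (norm x)\<^sup>2 \<le> x \<bullet> (S *v x)" and "0 < q" "0 < t"
  shows "norm X \<le> CARD('n) * (2 * norm A / (t * q))"
proof -
  have vec: "norm (X *v y) \<le> 2 * norm A / (t * q) * norm y" for y
  proof (cases "X *v y = 0")
    case False
    let ?z = "X *v y"
    have "t * (q * (norm ?z)\<^sup>2) \<le> t * (?z \<bullet> (S *v ?z))"
      using S \<open>0 < t\<close> by (intro mult_left_mono) auto
    also have "\<dots> \<le> - (2 * (?z \<bullet> (transpose A *v y)))"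
      using riccati_quadratic[OF eq X, of y] zero_le_power2[of "norm (transpose Bw *v y)"] by linarith
    also have "?z \<bullet> (transpose A *v y) = y \<bullet> (A *v ?z)"
      by (simp only: inner_matrix_mult_transpose[of y A] inner_commute)
    also have "- (2 * (y \<bullet> (A *v ?z))) \<le> 2 * (norm y * norm (A *v ?z))"
      using Cauchy_Schwarz_ineq2[of y "A *v ?z"] by linarith
    also have "\<dots> \<le> 2 * (norm y * (norm A * norm ?z))"
      by (intro mult_left_mono norm_matrix_vector_le) auto
    finally have "norm ?z * (t * q * norm ?z) \<le> norm ?z * (2 * norm A * norm y)"
      by (simp add: power2_eq_square mult_ac)
    then have "t * q * norm ?z \<le> 2 * norm A * norm y" using False by simp
    then show ?thesis using \<open>0 < q\<close> \<open>0 < t\<close> by (simp add: field_simps)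
  qed (use \<open>0 < q\<close> \<open>0 < t\<close> in simp)
  \<comment> \<open>Row i of the symmetric X is X at the i-th unit vector; the factor CARD('n) is
    the price for passing from the bound on vectors to the Frobenius norm.\<close>
  have row: "norm (X $ i) \<le> 2 * norm A / (t * q)" for i
  proof -
    have "X $ i = transpose X *v axis i 1"
      by (simp add: matrix_vector_mult_basis column_transpose row_def vec_nth_inverse del: transpose_matrix_vector)
    also have "\<dots> = X *v axis i 1" using X by (simp add: symmetric_mat_def del: transpose_matrix_vector)
    finally show ?thesis using vec[of "axis i 1"] by (simp add: norm_axis_1)
  qed
  have "norm X \<le> (\<Sum>i\<in>UNIV. norm (X $ i))"
    unfolding norm_vec_def[of X] by (rule L2_set_le_sum) simp
  also have "\<dots> \<le> CARD('n) * (2 * norm A / (t * q))"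
    using row by (intro sum_bounded_above) auto
  finally show ?thesis .
qed

text \<open>Squaring removes the matrix square roots, and the two output blocks recombine to the
  weight \<open>S_mat\<close>.\<close>

lemma norm_T_inf_sq:
  fixes A :: "real^'n^'n" and B :: "real^'m^'n"
  assumes "pd Qi" "pd Ri" "hurwitz (A + B ** K)" "resolvent_eq (A + B ** K) \<omega> (cvec a b) = cmat Bw *v w"
  shows "(norm (T_inf Qi Ri A B Bw K \<omega> w))\<^sup>2 = a \<bullet> (S_mat Qi Ri K *v a) + b \<bullet> (S_mat Qi Ri K *v b)"
proof -
  have K: "cmat (psd_sqrt Ri ** K) *v cvec a b = cvec (psd_sqrt Ri *v (K *v a)) (psd_sqrt Ri *v (K *v b))"
    by (simp add: cmat_mult_cvec matrix_vector_mul_assoc)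
  have pair: "(norm (x, y))\<^sup>2 = (norm x)\<^sup>2 + (norm y)\<^sup>2" for x :: "complex^'n" and y :: "complex^'m"
    by (simp add: norm_Pair)
  show ?thesis
    unfolding T_inf_apply[OF assms(3,4)] K
    unfolding cmat_mult_cvec pair norm_cvec
      norm_psd_sqrt_mult[OF assms(1)] norm_psd_sqrt_mult[OF assms(2)] inner_S_mat by simp
qed

text \<open>A left eigenvector \<open>u\<close> of the closed loop with eigenvalue on the imaginary axis yields the input
  \<open>w = B\<^sub>w\<^sup>T u\<close>, amplified by the factor \<open>\<beta>\<close> exactly, with state \<open>X u\<close>.\<close>
lemma closed_loop_no_imaginary_eigenvalue:
  fixes A :: "real^'n^'n" and B :: "real^'m^'n"
  assumes pd: "pd Qi" "pd Ri" and h: "hurwitz (A + B ** K)" and g: "gain_le Qi Ri A B Bw K g" "0 \<le> g" "g < \<beta>"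
    and X: "symmetric_mat X"
    and eq: "(A + B ** K) ** X + X ** transpose (A + B ** K) + inverse (\<beta>\<^sup>2) *\<^sub>R (X ** S_mat Qi Ri K ** X)
        + Bw ** transpose Bw = 0"
    and l: "eigenvalue_of (A + B ** K + inverse (\<beta>\<^sup>2) *\<^sub>R (X ** S_mat Qi Ri K)) l"
  shows "Re l \<noteq> 0"
proof
  assume Re: "Re l = 0"
  define t where "t = inverse (\<beta>\<^sup>2)"
  define A' where "A' = A + B ** K"
  define S where "S = S_mat Qi Ri K"
  define At where "At = transpose A'"
  define Bt where "Bt = transpose Bw"
  \<comment> \<open>Applied to the eigenvector u of the transposed closed loop, the Riccati equation
    reads (-l - A') X u = Bw Bw^T u; hence i \<omega> = -l.\<close>
  define \<omega> where "\<omega> = - Im l"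
  have S: "symmetric_mat S" using pd unfolding S_def by (intro symmetric_S_mat) (auto simp: pd_def)
  have "eigenvalue_of (At + t *\<^sub>R (S ** X)) l"
    using l unfolding At_def transpose_closed_loop[OF X S, symmetric] eigenvalue_of_transpose
    by (simp add: t_def S_def A'_def)
  then obtain u where u: "u \<noteq> 0" "cmat (At + t *\<^sub>R (S ** X)) *v u = l *s u" by (auto simp: eigenvalue_of_def)
  obtain a b where ab: "u = cvec a b" by (rule cvec_cases)
  have v: "(At + t *\<^sub>R (S ** X)) *v y = At *v y + t *\<^sub>R (S *v (X *v y))" for y
    by (simp add: matrix_vector_mult_add_rdistrib scaleR_matrix_vector_assoc[symmetric] matrix_vector_mul_assoc)
  have eig: "At *v a = \<omega> *\<^sub>R b - t *\<^sub>R (S *v (X *v a))" "At *v b = - \<omega> *\<^sub>R a - t *\<^sub>R (S *v (X *v b))"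
    using u(2) unfolding ab cmat_mult_cvec scale_cvec cvec_eq_iff v Re
    by (auto simp: \<omega>_def algebra_simps)
  have eq': "A' ** X + X ** transpose A' + t *\<^sub>R (X ** S ** X) + Bw ** transpose Bw = 0"
    using eq by (simp add: t_def A'_def S_def)
  note ric = riccati_vec[OF eq', folded At_def Bt_def] and qu = riccati_quadratic[OF eq' X, folded At_def Bt_def]
  have neg: "X *v (- y) = - (X *v y)" for y using matrix_vector_mult_diff_distrib[of X 0 y] by simp
  have res: "resolvent_eq A' \<omega> (cvec (X *v a) (X *v b)) = cmat Bw *v cvec (Bt *v a) (Bt *v b)"
  proof -
    have "A' *v (X *v a) + \<omega> *\<^sub>R (X *v b) + Bw *v (Bt *v a) = 0"
      using ric[of a] unfolding eig by (simp add: matrix_vector_mult_diff_distrib matrix_vector_mult_scaleR)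
    moreover have "A' *v (X *v b) - \<omega> *\<^sub>R (X *v a) + Bw *v (Bt *v b) = 0"
      using ric[of b] unfolding eig by (simp add: neg matrix_vector_mult_diff_distrib matrix_vector_mult_scaleR)
    moreover have "z = - x - y" if "x + y + z = 0" for x y z :: "real^'n"
    proof -
      have "z = (x + y + z) - x - y" by simp
      with that show ?thesis by simp
    qed
    ultimately have "Bw *v (Bt *v a) = - (A' *v (X *v a)) - \<omega> *\<^sub>R (X *v b)"
      and "Bw *v (Bt *v b) = - (A' *v (X *v b)) - - (\<omega> *\<^sub>R (X *v a))"
      by (metis, metis diff_conv_add_uminus)
    then show ?thesis
      unfolding resolvent_eq_def cmat_mult_cvec scale_cvec cvec_diff cvec_eq_iff by simp
  qed
  define N where "N = (X *v a) \<bullet> (S *v (X *v a)) + (X *v b) \<bullet> (S *v (X *v b))"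
  \<comment> \<open>The terms in \<omega> coming from a and b cancel because X is symmetric. N is
    the squared norm of the output.\<close>
  have w2: "(norm (cvec (Bt *v a) (Bt *v b)))\<^sup>2 = t * N"
  proof -
    have "(X *v a) \<bullet> (At *v a) = \<omega> * ((X *v a) \<bullet> b) - t * ((X *v a) \<bullet> (S *v (X *v a)))"
      unfolding eig by (simp add: inner_diff_right)
    moreover have "(X *v b) \<bullet> (At *v b) = - \<omega> * ((X *v b) \<bullet> a) - t * ((X *v b) \<bullet> (S *v (X *v b)))"
      unfolding eig by (simp add: inner_diff_right)
    moreover have "(X *v b) \<bullet> a = (X *v a) \<bullet> b"
      using symmetric_mat_inner[OF X, of a b] by (simp add: inner_commute)
    ultimately show ?thesis
      using qu[of a] qu[of b] unfolding norm_cvec N_def by (simp add: algebra_simps)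
  qed
  have "(norm (T_inf Qi Ri A B Bw K \<omega> (cvec (Bt *v a) (Bt *v b))))\<^sup>2 = N"
    unfolding N_def S_def using pd h res unfolding A'_def by (rule norm_T_inf_sq)
  moreover have "(norm (T_inf Qi Ri A B Bw K \<omega> (cvec (Bt *v a) (Bt *v b))))\<^sup>2 \<le> (g * norm (cvec (Bt *v a) (Bt *v b)))\<^sup>2"
    using g(1) unfolding gain_le_def by (intro power_mono) auto
  ultimately have le: "N \<le> g\<^sup>2 * (t * N)" by (simp add: power_mult_distrib w2)
  have t: "0 < t" and gt: "g\<^sup>2 * t < 1"
    using g(2,3) power_strict_mono[OF g(3,2), of 2] by (auto simp: t_def field_simps)
  have "0 \<le> t * N" unfolding w2[symmetric] by simp
  then have "0 \<le> N" using t by (simp add: zero_le_mult_iff)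
  have "N = 0"
  proof (rule ccontr)
    assume "N \<noteq> 0"
    then have "(g\<^sup>2 * t) * N < 1 * N" using gt \<open>0 \<le> N\<close> by (intro mult_strict_right_mono) auto
    with le show False by simp
  qed
  \<comment> \<open>The input vanishes, hence so does the state X u by the resolvent bound; u is
    then an eigenvector of the transpose of A' itself, against the Hurwitz property of A'.\<close>
  then have "cvec (Bt *v a) (Bt *v b) = 0" using w2 by simp
  then have "resolvent_eq A' \<omega> (cvec (X *v a) (X *v b)) = 0" using res by simp
  then have "cvec (X *v a) (X *v b) = 0"
    using resolvent_bound[OF h] unfolding A'_def by (metis mult_zero_right norm_le_zero_iff norm_zero)
  then have "X *v a = 0" "X *v b = 0" unfolding cvec_0[symmetric] by simp_all
  then have "cmat At *v u = l *s u"
    unfolding ab cmat_mult_cvec scale_cvec cvec_eq_iff eig using Re by (simp add: \<omega>_def)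
  then have "eigenvalue_of A' l"
    using u(1) eigenvalue_of_transpose[of A' l] unfolding At_def eigenvalue_of_def by blast
  then have "Re l < 0" using h unfolding A'_def hurwitz_iff_eigenvalue by blast
  with Re show False by simp
qed

lemma tendsto_transpose: "(M \<longlongrightarrow> L) F \<Longrightarrow> ((\<lambda>x. transpose (M x :: real^'a^'b)) \<longlongrightarrow> transpose L) F"
  unfolding transpose_def by (intro tendsto_vec_lambda tendsto_vec_nth)

text \<open>The coercivity constant q comes from \<open>Qi\<close> alone, so the solutions are
  bounded uniformly in k. Symmetry and equation pass to the limit of a subsequence; the Hurwitz
  property passes only as Re l <= 0 and is made strict by the gain at K0.\<close>

lemma stabilizing_closed:
  fixes A :: "real^'n^'n" and B :: "real^'m^'n"
  assumes pd: "pd Qi" "pd Ri" and \<beta>: "0 < \<beta>" and K0: "K0 \<in> Kbeta Qi Ri A B Bw \<beta>" and lim: "K \<longlonglongrightarrow> K0"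
    and X: "\<And>k. stabilizing (inverse (\<beta>\<^sup>2)) (S_mat Qi Ri (K k)) (A + B ** K k) (Bw ** transpose Bw) (X k)"
  shows "\<exists>X0. stabilizing (inverse (\<beta>\<^sup>2)) (S_mat Qi Ri K0) (A + B ** K0) (Bw ** transpose Bw) X0"
proof -
  let ?t = "inverse (\<beta>\<^sup>2)"
  obtain q where q: "0 < q" "\<And>x. q * (norm x)\<^sup>2 \<le> x \<bullet> (Qi *v x)"
    using pd_coercive[OF pd(1)] by blast
  have S: "q * (norm x)\<^sup>2 \<le> x \<bullet> (S_mat Qi Ri (K k) *v x)" for x k
  proof -
    have "0 \<le> (K k *v x) \<bullet> (Ri *v (K k *v x))"
      using pd(2) by (cases "K k *v x = 0") (auto simp: pd_def less_imp_le)
    then show ?thesis unfolding inner_S_mat using q(2)[of x] by linarith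
  qed
  have t: "0 < ?t" using \<beta> by simp
  have Alim: "(\<lambda>k. A + B ** K k) \<longlonglongrightarrow> A + B ** K0"
    by (intro tendsto_intros matrix_mult.tendsto lim)
  have Slim: "(\<lambda>k. S_mat Qi Ri (K k)) \<longlonglongrightarrow> S_mat Qi Ri K0"
    unfolding S_mat_def by (intro tendsto_add tendsto_const matrix_mult.tendsto tendsto_transpose lim)
  obtain c where c: "\<And>k. norm (A + B ** K k) \<le> c"
    using convergent_imp_bounded[OF Alim] by (auto simp: bounded_iff)
  have "norm (X k) \<le> CARD('n) * (2 * c / (?t * q))" for k
  proof -
    have "norm (X k) \<le> CARD('n) * (2 * norm (A + B ** K k) / (?t * q))"
      using X[of k] unfolding stabilizing_def by (intro riccati_bound[OF _ _ S q(1) t]) auto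
    also have "\<dots> \<le> CARD('n) * (2 * c / (?t * q))"
      using c[of k] q(1) t by (intro mult_left_mono divide_right_mono) auto
    finally show ?thesis .
  qed
  then have "bounded (range X)" by (auto simp: bounded_iff)
  then obtain X0 s where s: "strict_mono s" "(X \<circ> s) \<longlonglongrightarrow> X0"
    using bounded_imp_convergent_subsequence by blast
  have Xs: "(\<lambda>k. X (s k)) \<longlonglongrightarrow> X0" using s(2) by (simp add: o_def)
  have Ss: "(\<lambda>k. S_mat Qi Ri (K (s k))) \<longlonglongrightarrow> S_mat Qi Ri K0"
    using LIMSEQ_subseq_LIMSEQ[OF Slim s(1)] by (simp add: o_def)
  have sym: "symmetric_mat X0"
  proof -
    have "transpose (X (s k)) = X (s k)" for k
      using X by (simp add: stabilizing_def symmetric_mat_def)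
    then have "(X \<circ> s) \<longlonglongrightarrow> transpose X0" using tendsto_transpose[OF Xs] by (simp add: o_def)
    then show ?thesis unfolding symmetric_mat_def using s(2) by (rule LIMSEQ_unique)
  qed
  have eq: "(A + B ** K0) ** X0 + X0 ** transpose (A + B ** K0) + ?t *\<^sub>R (X0 ** S_mat Qi Ri K0 ** X0)
      + Bw ** transpose Bw = 0"
  proof (rule LIMSEQ_unique)
    show "(\<lambda>k. (A + B ** K (s k)) ** X (s k) + X (s k) ** transpose (A + B ** K (s k))
        + ?t *\<^sub>R (X (s k) ** S_mat Qi Ri (K (s k)) ** X (s k)) + Bw ** transpose Bw)
      \<longlonglongrightarrow> (A + B ** K0) ** X0 + X0 ** transpose (A + B ** K0) + ?t *\<^sub>R (X0 ** S_mat Qi Ri K0 ** X0)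
      + Bw ** transpose Bw"
      using Xs Ss LIMSEQ_subseq_LIMSEQ[OF lim s(1), unfolded o_def]
      by (intro tendsto_add tendsto_scaleR tendsto_const matrix_mult.tendsto tendsto_transpose)
    show "(\<lambda>k. (A + B ** K (s k)) ** X (s k) + X (s k) ** transpose (A + B ** K (s k))
        + ?t *\<^sub>R (X (s k) ** S_mat Qi Ri (K (s k)) ** X (s k)) + Bw ** transpose Bw) \<longlonglongrightarrow> 0"
      using X by (simp add: stabilizing_def)
  qed
  obtain g where g: "hurwitz (A + B ** K0)" "0 \<le> g" "g < \<beta>" "gain_le Qi Ri A B Bw K0 g"
    using K0 unfolding Kbeta_iff[OF \<beta>] by blast
  have "Re l < 0" if l: "eigenvalue_of (A + B ** K0 + ?t *\<^sub>R (X0 ** S_mat Qi Ri K0)) l" for l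
  proof -
    have "(\<lambda>k. A + B ** K (s k) + ?t *\<^sub>R (X (s k) ** S_mat Qi Ri (K (s k)))) \<longlonglongrightarrow> A + B ** K0 + ?t *\<^sub>R (X0 ** S_mat Qi Ri K0)"
      using Xs Ss LIMSEQ_subseq_LIMSEQ[OF lim s(1), unfolded o_def]
      by (intro tendsto_add tendsto_scaleR tendsto_const matrix_mult.tendsto)
    then have "Re l \<le> 0"
      using X l by (intro hurwitz_limit_eigenvalue) (auto simp: stabilizing_def)
    moreover have "Re l \<noteq> 0"
      using closed_loop_no_imaginary_eigenvalue[OF pd g(1,4,2,3) sym eq l] .
    ultimately show ?thesis by simp
  qed
  then have "hurwitz (A + B ** K0 + ?t *\<^sub>R (X0 ** S_mat Qi Ri K0))" by (simp add: hurwitz_iff_eigenvalue)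
  with sym eq show ?thesis unfolding stabilizing_def by blast
qed

section \<open>Analytic dependence on the gain\<close>

text \<open>One constant for all radii up to 1, so that the radius can be fixed after all constants
  are known.\<close>

definition uniformly_ana :: "(real^'c^'r \<Rightarrow> 'a::banach) \<Rightarrow> bool" where
  "uniformly_ana f \<longleftrightarrow> (\<exists>C\<ge>0. \<forall>r. 0 < r \<longrightarrow> r \<le> 1 \<longrightarrow> ana r C f)"

text \<open>The class of data that vanish at 0, with a bound proportional to the radius.\<close>

definition small_ana :: "(real^'c^'r \<Rightarrow> 'a::banach) \<Rightarrow> bool" where
  "small_ana f \<longleftrightarrow> (\<exists>C\<ge>0. \<forall>r. 0 < r \<longrightarrow> r \<le> 1 \<longrightarrow> ana r (C * r) f)"

lemma small_imp_uniformly_ana: "small_ana f \<Longrightarrow> uniformly_ana f"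
  unfolding small_ana_def uniformly_ana_def by (meson ana_mono mult_left_le)

lemma uniformly_ana_const: "uniformly_ana (\<lambda>_. a)"
  unfolding uniformly_ana_def using ana_const norm_ge_zero by blast

lemma small_ana_linear_fun: "linear T \<Longrightarrow> small_ana T"
  unfolding small_ana_def using ana_linear_fun by blast

lemma uniformly_ana_add:
  assumes "uniformly_ana f" "uniformly_ana g"
  shows "uniformly_ana (\<lambda>H. f H + g H)"
proof -
  obtain C D where "0 \<le> C" "0 \<le> D" "\<And>r. 0 < r \<Longrightarrow> r \<le> 1 \<Longrightarrow> ana r C f" "\<And>r. 0 < r \<Longrightarrow> r \<le> 1 \<Longrightarrow> ana r D g"
    using assms unfolding uniformly_ana_def by blast
  then show ?thesis
    unfolding uniformly_ana_def by (intro exI[of _ "C + D"]) (simp add: ana_add)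
qed

lemma small_ana_add:
  assumes "small_ana f" "small_ana g"
  shows "small_ana (\<lambda>H. f H + g H)"
proof -
  obtain C D where "0 \<le> C" "0 \<le> D" "\<And>r. 0 < r \<Longrightarrow> r \<le> 1 \<Longrightarrow> ana r (C * r) f" "\<And>r. 0 < r \<Longrightarrow> r \<le> 1 \<Longrightarrow> ana r (D * r) g"
    using assms unfolding small_ana_def by blast
  then show ?thesis
    unfolding small_ana_def by (intro exI[of _ "C + D"]) (simp add: ana_add distrib_right)
qed

lemma small_ana_linear:
  assumes "small_ana f" "bounded_linear T"
  shows "small_ana (\<lambda>H. T (f H))"
proof -
  obtain C where C: "0 \<le> C" "\<And>r. 0 < r \<Longrightarrow> r \<le> 1 \<Longrightarrow> ana r (C * r) f"
    using assms(1) unfolding small_ana_def by blast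
  obtain L where L: "0 \<le> L" "\<And>x. norm (T x) \<le> L * norm x"
    using bounded_linear.nonneg_bounded[OF assms(2)] by (auto simp: mult.commute)
  have "ana r (L * C * r) (\<lambda>H. T (f H))" if "0 < r" "r \<le> 1" for r
    using ana_linear[OF C(2)[OF that] that(1) assms(2) L(2,1)] by (simp add: mult.assoc)
  then show ?thesis
    unfolding small_ana_def using C(1) L(1) by (intro exI[of _ "L * C"]) simp
qed

lemma uniformly_ana_linear:
  assumes "uniformly_ana f" "bounded_linear T"
  shows "uniformly_ana (\<lambda>H. T (f H))"
proof -
  obtain C where C: "0 \<le> C" "\<And>r. 0 < r \<Longrightarrow> r \<le> 1 \<Longrightarrow> ana r C f"
    using assms(1) unfolding uniformly_ana_def by blast
  obtain L where L: "0 \<le> L" "\<And>x. norm (T x) \<le> L * norm x"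
    using bounded_linear.nonneg_bounded[OF assms(2)] by (auto simp: mult.commute)
  have "ana r (L * C) (\<lambda>H. T (f H))" if "0 < r" "r \<le> 1" for r
    using ana_linear[OF C(2)[OF that] that(1) assms(2) L(2,1)] .
  then show ?thesis
    unfolding uniformly_ana_def using C(1) L(1) by (intro exI[of _ "L * C"]) simp
qed

lemma uniformly_ana_matrix_mult:
  assumes "uniformly_ana f" "uniformly_ana g"
  shows "uniformly_ana (\<lambda>H. (f H :: real^'b^'a) ** (g H :: real^'c^'b))"
proof -
  obtain C D where "0 \<le> C" "0 \<le> D" "\<And>r. 0 < r \<Longrightarrow> r \<le> 1 \<Longrightarrow> ana r C f" "\<And>r. 0 < r \<Longrightarrow> r \<le> 1 \<Longrightarrow> ana r D g"
    using assms unfolding uniformly_ana_def by blast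
  then show ?thesis
    unfolding uniformly_ana_def by (intro exI[of _ "C * D"]) (simp add: ana_matrix_mult)
qed

lemma small_ana_matrix_mult:
  assumes "small_ana f" "uniformly_ana g"
  shows "small_ana (\<lambda>H. (f H :: real^'b^'a) ** (g H :: real^'c^'b))"
proof -
  obtain C D where C: "0 \<le> C" "0 \<le> D" "\<And>r. 0 < r \<Longrightarrow> r \<le> 1 \<Longrightarrow> ana r (C * r) f" "\<And>r. 0 < r \<Longrightarrow> r \<le> 1 \<Longrightarrow> ana r D g"
    using assms unfolding small_ana_def uniformly_ana_def by blast
  have "ana r (C * D * r) (\<lambda>H. f H ** g H)" if "0 < r" "r \<le> 1" for r
    using ana_matrix_mult[OF C(3,4) \<open>0 < r\<close>] that by (simp add: mult_ac)
  then show ?thesis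
    unfolding small_ana_def using C(1,2) by (intro exI[of _ "C * D"]) simp
qed

lemma linear_transpose: "linear (transpose :: real^'a^'b \<Rightarrow> real^'b^'a)"
  by (rule linearI) (simp_all add: transpose_add transpose_scalar)

lemma bounded_linear_matrix_trace: "bounded_linear (trace :: real^'n^'n \<Rightarrow> real)"
  unfolding linear_conv_bounded_linear[symmetric]
  by (rule linearI) (simp_all add: trace_def sum.distrib sum_distrib_left)

lemma norm_transpose: "norm (transpose (M :: real^'a^'b)) = norm M"
proof -
  have "(norm N)\<^sup>2 = (\<Sum>i\<in>UNIV. \<Sum>j\<in>UNIV. (N $ i $ j)\<^sup>2)" for N :: "real^'x^'y"
    by (simp add: norm_vec_def L2_set_def sum_nonneg)
  from this[of "transpose M"] this[of M] have "(norm (transpose M))\<^sup>2 = (norm M)\<^sup>2"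
    by (simp add: transpose_def) (rule sum.swap)
  then show ?thesis by (simp add: power2_eq_iff_nonneg)
qed

lemma transpose_diff: "transpose (M - N) = transpose M - transpose (N :: real^'a^'b)"
  by (simp add: transpose_def vec_eq_iff)

text \<open>Serves for the weight in the Riccati equation and for the weight in the cost, which have
  the same shape.\<close>

lemma quadratic_ana:
  fixes K0 :: "real^'n^'m"
  shows "uniformly_ana (\<lambda>H. Q + transpose (K0 + H) ** R ** (K0 + H))"
proof -
  have K: "uniformly_ana (\<lambda>H::real^'n^'m. K0 + H)"
    by (intro uniformly_ana_add uniformly_ana_const small_imp_uniformly_ana small_ana_linear_fun linear_id[unfolded id_def])
  have "uniformly_ana (\<lambda>H. transpose (K0 + H))"
    using K linear_transpose[unfolded linear_conv_bounded_linear] by (rule uniformly_ana_linear)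
  then show ?thesis
    by (rule uniformly_ana_add[OF uniformly_ana_const
      uniformly_ana_matrix_mult[OF uniformly_ana_matrix_mult[OF _ uniformly_ana_const] K]])
qed

text \<open>The constant terms cancel; every other term contains H or its transpose, and one such
  factor is enough for smallness.\<close>

lemma S_mat_increment_small:
  fixes K0 :: "real^'n^'m"
  shows "small_ana (\<lambda>H. S_mat Qi Ri (K0 + H) - S_mat Qi Ri K0)"
proof -
  have id: "small_ana (\<lambda>H::real^'n^'m. H)" by (intro small_ana_linear_fun linear_id[unfolded id_def])
  have tr: "small_ana (\<lambda>H::real^'n^'m. transpose H)" by (intro small_ana_linear_fun linear_transpose)
  have "small_ana (\<lambda>H::real^'n^'m. transpose K0 ** Ri ** H)"
    by (rule small_ana_linear_fun[OF bounded_linear.linear[OF matrix_mult.bounded_linear_right]])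
  moreover have "small_ana (\<lambda>H::real^'n^'m. transpose H ** (Ri ** K0))"
    by (rule small_ana_matrix_mult[OF tr uniformly_ana_const])
  moreover have "small_ana (\<lambda>H::real^'n^'m. transpose H ** (Ri ** H))"
    by (intro small_ana_matrix_mult tr uniformly_ana_matrix_mult uniformly_ana_const small_imp_uniformly_ana id)
  ultimately have "small_ana (\<lambda>H. transpose K0 ** Ri ** H + transpose H ** (Ri ** K0) + transpose H ** (Ri ** H))"
    by (intro small_ana_add)
  moreover have "transpose K0 ** Ri ** H + transpose H ** (Ri ** K0) + transpose H ** (Ri ** H)
      = S_mat Qi Ri (K0 + H) - S_mat Qi Ri K0" for H
    by (simp add: S_mat_def transpose_add matrix_mult.add_left matrix_mult.add_right matrix_mul_assoc)
  ultimately show ?thesis by simp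
qed

lemma mult_le_of_le_divide:
  fixes a b x :: real
  assumes "0 \<le> a" "0 < b" "0 \<le> x" "x \<le> b / (a + 1)"
  shows "a * x \<le> b"
proof -
  have "a * x \<le> (a + 1) * x" using assms by (intro mult_right_mono) auto
  also have "\<dots> \<le> b" using assms by (simp add: field_simps)
  finally show ?thesis .
qed

text \<open>An analytic implicit function theorem for the Riccati equation: with \<open>X = X\<^sub>0 + Y\<close> it reads
  \<open>Y = -L\<^sup>-\<^sup>1(P + N Y + Y N\<^sup>T + t Y S Y)\<close>, where \<open>L\<close> is the Lyapunov operator of the closed loop at \<open>K\<^sub>0\<close>
  and \<open>P\<close>, \<open>N\<close> vanish at \<open>K\<^sub>0\<close>.\<close>
lemma stabilizing_analytic:
  fixes A :: "real^'n^'n" and B :: "real^'m^'n" and K0 :: "real^'n^'m"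
  assumes Q: "symmetric_mat Qi" and R: "symmetric_mat Ri" and W: "symmetric_mat W"
    and X0: "stabilizing t (S_mat Qi Ri K0) (A + B ** K0) W X0"
  obtains r C X where "0 < r" "r \<le> 1" "ana r C X"
    "\<And>H. H \<in> mbox r \<Longrightarrow> stabilizing t (S_mat Qi Ri (K0 + H)) (A + B ** (K0 + H)) W (X H)"
proof -
  define S where "S H = S_mat Qi Ri (K0 + H)" for H
  define S0 where "S0 = S_mat Qi Ri K0"
  define A0 where "A0 = A + B ** K0"
  have symS: "symmetric_mat (S H)" "symmetric_mat S0" for H
    unfolding S_def S0_def using Q R by (auto intro: symmetric_S_mat)
  have symX0: "symmetric_mat X0" using X0 by (simp add: stabilizing_def)
  define F where "F = A0 + t *\<^sub>R (X0 ** S0)"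
  have hF: "hurwitz F" using X0 by (simp add: stabilizing_def F_def A0_def S0_def)
  have trF: "transpose F = transpose A0 + t *\<^sub>R (S0 ** X0)"
    unfolding F_def by (intro transpose_closed_loop symX0 symS)
  define L where "L Y = F ** Y + Y ** transpose F" for Y
  have linL: "linear L"
    by (rule linearI) (simp_all add: L_def matrix_mult.add_left matrix_mult.add_right matrix_mult.scaleR_left
        matrix_mult.scaleR_right scaleR_add_right)
  \<comment> \<open>L is the Sylvester operator with both coefficients F; injectivity gives an
    inverse in finite dimension.\<close>
  have injL: "inj L"
    unfolding linear_injective_0[OF linL] L_def by (intro allI impI) (rule sylvester_unique[OF hF hF])
  obtain G where G: "linear G" "\<And>x. G (L x) = x" "\<And>x. L (G x) = x"
    using linear_injective_isomorphism[OF linL injL] by blast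
  define T where "T Y = - G Y" for Y
  have linT: "linear T" unfolding T_def using G(1) by (intro linear_compose_neg)
  have T_iff: "Y = T Z \<longleftrightarrow> L Y + Z = 0" for Y Z
    unfolding T_def using G linear_neg[OF G(1)] linear_neg[OF linL]
    by (metis add.right_inverse add_eq_0_iff minus_minus)
  obtain l where l: "0 < l" "\<And>x. norm (T x) \<le> l * norm x"
    using linear_bounded_pos[OF linT] by blast
  define \<Delta> where "\<Delta> H = S H - S0" for H
  define N where "N H = B ** H + t *\<^sub>R (X0 ** \<Delta> H)" for H
  define P where "P H = B ** H ** X0 + X0 ** transpose (B ** H) + t *\<^sub>R (X0 ** \<Delta> H ** X0)" for H
  have trN: "transpose (N H) = transpose (B ** H) + t *\<^sub>R (\<Delta> H ** X0)" for H
    using symS(1)[of H] symS(2) symX0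
    by (simp add: N_def \<Delta>_def transpose_add transpose_diff transpose_scalar matrix_transpose_mul symmetric_mat_def
        matrix_mult.diff_left matrix_mult.diff_right)
  \<comment> \<open>W is eliminated by the equation at K0. The terms free of Y form P, the linear
    ones split into L and the small part N, and t moves into S.\<close>
  have riccati: "(A + B ** (K0 + H)) ** (X0 + Y) + (X0 + Y) ** transpose (A + B ** (K0 + H))
      + t *\<^sub>R ((X0 + Y) ** S H ** (X0 + Y)) + W
      = L Y + (P H + N H ** Y + Y ** transpose (N H) + Y ** (t *\<^sub>R S H) ** Y)" for H Y
  proof -
    have AH: "A + B ** (K0 + H) = A0 + B ** H" by (simp add: A0_def matrix_mult.add_right)
    have SH: "S H = S0 + \<Delta> H" by (simp add: \<Delta>_def)
    have "A0 ** X0 + X0 ** transpose A0 + t *\<^sub>R (X0 ** S0 ** X0) + W = 0"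
      using X0 by (simp add: stabilizing_def A0_def S0_def)
    then have Weq: "W = - (A0 ** X0 + X0 ** transpose A0 + t *\<^sub>R (X0 ** S0 ** X0))"
      by (simp add: add_eq_0_iff2 add.commute)
    show ?thesis
      unfolding AH SH Weq L_def trF trN P_def
      by (simp add: F_def N_def transpose_add matrix_mult.add_left matrix_mult.add_right matrix_mult.scaleR_left
        matrix_mult.scaleR_right scaleR_add_right matrix_mul_assoc)
  qed
  have closed_loop: "A + B ** (K0 + H) + t *\<^sub>R ((X0 + Y) ** S H) = F + (N H + Y ** (t *\<^sub>R S H))" for H Y
    by (simp add: F_def N_def \<Delta>_def A0_def matrix_mult.add_left matrix_mult.add_right matrix_mult.scaleR_left
        matrix_mult.diff_left matrix_mult.diff_right matrix_mult.scaleR_right scaleR_add_right scaleR_diff_right)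
  have small\<Delta>: "small_ana \<Delta>"
    unfolding \<Delta>_def S_def S0_def by (rule S_mat_increment_small)
  have smallBH: "small_ana (\<lambda>H. B ** H)"
    by (intro small_ana_linear_fun bounded_linear.linear[OF matrix_mult.bounded_linear_right])
  have smallN: "small_ana N"
    unfolding N_def
    by (intro small_ana_add smallBH
        small_ana_linear[OF small_ana_linear[OF small\<Delta> matrix_mult.bounded_linear_right] bounded_linear_scaleR_right])
  have smallP: "small_ana P"
    unfolding P_def
    by (intro small_ana_add
        small_ana_linear[OF smallBH matrix_mult.bounded_linear_left]
        small_ana_linear[OF small_ana_linear[OF smallBH linear_transpose[unfolded linear_conv_bounded_linear]] matrix_mult.bounded_linear_right]
        small_ana_linear[OF small_ana_linear[OF small_ana_linear[OF small\<Delta> matrix_mult.bounded_linear_right]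
          matrix_mult.bounded_linear_left] bounded_linear_scaleR_right])
  have "uniformly_ana (\<lambda>H. t *\<^sub>R S H)"
    unfolding S_def S_mat_def using quadratic_ana bounded_linear_scaleR_right by (rule uniformly_ana_linear)
  then obtain \<sigma> where \<sigma>: "0 \<le> \<sigma>" "\<And>r. 0 < r \<Longrightarrow> r \<le> 1 \<Longrightarrow> ana r \<sigma> (\<lambda>H. t *\<^sub>R S H)"
    unfolding uniformly_ana_def by blast
  obtain p where p: "0 \<le> p" "\<And>r. 0 < r \<Longrightarrow> r \<le> 1 \<Longrightarrow> ana r (p * r) P"
    using smallP unfolding small_ana_def by blast
  obtain \<nu>1 where \<nu>1: "0 \<le> \<nu>1" "\<And>r. 0 < r \<Longrightarrow> r \<le> 1 \<Longrightarrow> ana r (\<nu>1 * r) N"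
    using smallN unfolding small_ana_def by blast
  obtain e where e: "0 < e" "\<And>M. dist M F < e \<Longrightarrow> hurwitz M"
    using hurwitz_open hF unfolding open_dist by blast
  \<comment> \<open>\<sigma> does not shrink with the radius, so \<rho> has to tame it; r follows,
    since l p r <= \<rho> / 2 is needed. The two quarters make the contraction factor 1/2. The two
    thirds of e keep the closed loop, which is F perturbed by N + Y (t S), in the ball around F
    where matrices are Hurwitz.\<close>
  define \<rho> where "\<rho> = min (1/4 / (2 * l * \<sigma> + 1)) (e / 3 / (\<sigma> + 1))"
  have "0 < \<rho>" using l(1) \<sigma>(1) e(1) by (simp add: \<rho>_def add_nonneg_pos)
  define r where "r = min 1 (min (min (1/4 / (2 * l * \<nu>1 + 1)) (\<rho> / 2 / (l * p + 1))) (e / 3 / (\<nu>1 + 1)))"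
  have r: "0 < r" "r \<le> 1"
    using l(1) \<nu>1(1) p(1) e(1) \<open>0 < \<rho>\<close> by (auto simp: r_def add_nonneg_pos)
  have "\<rho> \<le> 1/4 / (2 * l * \<sigma> + 1)" "\<rho> \<le> e / 3 / (\<sigma> + 1)" unfolding \<rho>_def by linarith+
  then have b1: "2 * l * \<sigma> * \<rho> \<le> 1/4" "\<sigma> * \<rho> \<le> e / 3"
    using l(1) \<sigma>(1) e(1) \<open>0 < \<rho>\<close> by (intro mult_le_of_le_divide; simp)+
  have "r \<le> 1/4 / (2 * l * \<nu>1 + 1)" "r \<le> \<rho> / 2 / (l * p + 1)" "r \<le> e / 3 / (\<nu>1 + 1)" unfolding r_def by linarith+
  then have b2: "2 * l * \<nu>1 * r \<le> 1/4" "l * p * r \<le> \<rho> / 2" "\<nu>1 * r \<le> e / 3"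
    using l(1) \<nu>1(1) p(1) e(1) \<open>0 < \<rho>\<close> r(1) by (intro mult_le_of_le_divide; simp)+
  have small: "l * (p * r) \<le> \<rho> / 2" "l * (2 * (\<nu>1 * r) + 2 * \<rho> * \<sigma>) \<le> 1/2"
    using b1 b2 by (auto simp: algebra_simps)
  have N: "ana r (\<nu>1 * r) N" using \<nu>1(2) r by blast
  have blt: "bounded_linear (transpose :: real^'n^'n \<Rightarrow> _)"
    using linear_transpose linear_conv_bounded_linear by blast
  have N': "ana r (\<nu>1 * r) (\<lambda>H. transpose (N H))"
    using ana_linear[OF N r(1) blt, of 1] by (simp add: norm_transpose)
  obtain Y where Y: "ana r \<rho> Y"
    "\<And>H. H \<in> mbox r \<Longrightarrow> Y H = T (P H + N H ** Y H + Y H ** transpose (N H) + Y H ** (t *\<^sub>R S H) ** Y H)"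
    using ana_quadratic_fixpoint[OF linT l(2) less_imp_le[OF l(1)] r(1) less_imp_le[OF \<open>0 < \<rho>\<close>]
        p(2)[OF r] N N' \<sigma>(2)[OF r] small] by blast
  show thesis
  proof
    show "ana r (norm X0 + \<rho>) (\<lambda>H. X0 + Y H)"
      using r(1) by (intro ana_add ana_const Y(1)) simp_all
    fix H :: "real^'n^'m" assume H: "H \<in> mbox r"
    have nY: "norm (Y H) \<le> \<rho>" using Y(1) H by (rule ana_norm_le)
    have nS: "norm (t *\<^sub>R S H) \<le> \<sigma>" using \<sigma>(2)[OF r] H by (rule ana_norm_le)
    have nN: "norm (N H) \<le> \<nu>1 * r" using N H by (rule ana_norm_le)
    have fix_iff: "Z = T (P H + N H ** Z + Z ** transpose (N H) + Z ** (t *\<^sub>R S H) ** Z) \<longleftrightarrow>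
       (A + B ** (K0 + H)) ** (X0 + Z) + (X0 + Z) ** transpose (A + B ** (K0 + H))
      + t *\<^sub>R ((X0 + Z) ** S H ** (X0 + Z)) + W = 0" for Z
      unfolding T_iff riccati ..
    have eq: "(A + B ** (K0 + H)) ** (X0 + Y H) + (X0 + Y H) ** transpose (A + B ** (K0 + H))
      + t *\<^sub>R ((X0 + Y H) ** S H ** (X0 + Y H)) + W = 0"
      using Y(2)[OF H] unfolding fix_iff .
    \<comment> \<open>Transposition maps the Riccati equation to itself, so the transpose is a fixed
      point in the same ball.\<close>
    have "transpose (Y H) = Y H"
    proof (rule contraction_unique[OF linT l(2) less_imp_le[OF l(1)] nN _ nS small(2)])
      show "norm (transpose (N H)) \<le> \<nu>1 * r" using nN by (simp add: norm_transpose)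
      show "norm (transpose (Y H)) \<le> \<rho>" "norm (Y H) \<le> \<rho>" using nY by (simp_all add: norm_transpose)
      show "Y H = T (P H + N H ** Y H + Y H ** transpose (N H) + Y H ** (t *\<^sub>R S H) ** Y H)" by (rule Y(2)[OF H])
      have "transpose ((A + B ** (K0 + H)) ** (X0 + Y H) + (X0 + Y H) ** transpose (A + B ** (K0 + H))
          + t *\<^sub>R ((X0 + Y H) ** S H ** (X0 + Y H)) + W) = 0"
        unfolding eq by (simp add: transpose_def vec_eq_iff)
      then show "transpose (Y H) = T (P H + N H ** transpose (Y H) + transpose (Y H) ** transpose (N H)
          + transpose (Y H) ** (t *\<^sub>R S H) ** transpose (Y H))"
        unfolding fix_iff using symS(1)[of H] symX0 W
        by (simp add: transpose_add transpose_scalar matrix_transpose_mul symmetric_mat_def matrix_mul_assoc add_ac)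
    qed
    then have sym: "symmetric_mat (X0 + Y H)"
      using symX0 by (simp add: symmetric_mat_def transpose_add)
    have "norm (N H + Y H ** (t *\<^sub>R S H)) < e"
    proof -
      have "norm (Y H ** (t *\<^sub>R S H)) \<le> \<rho> * \<sigma>"
        using norm_matrix_mult_le[of "Y H" "t *\<^sub>R S H"] mult_mono[OF nY nS] \<open>0 < \<rho>\<close> by simp
      then show ?thesis
        using norm_triangle_ineq[of "N H" "Y H ** (t *\<^sub>R S H)"] nN b1(2) b2(3) e(1) by (simp add: mult.commute)
    qed
    then have "hurwitz (A + B ** (K0 + H) + t *\<^sub>R ((X0 + Y H) ** S H))"
      unfolding closed_loop by (intro e(2)) (simp add: dist_norm)
    with sym eq show "stabilizing t (S_mat Qi Ri (K0 + H)) (A + B ** (K0 + H)) W (X0 + Y H)"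
      unfolding stabilizing_def S_def by blast
  qed (use r in auto)
qed

section \<open>From the Riccati solution to the cost\<close>

lemma X_sol_eq:
  "X_sol Qi Ri A B Bw \<beta> K
    = (THE X. stabilizing (inverse (\<beta>\<^sup>2)) (S_mat Qi Ri K) (A + B ** K) (Bw ** transpose Bw) X)"
  unfolding X_sol_def stabilizing_def ..

lemma X_sol_stabilizing:
  assumes "symmetric_mat Qi" "symmetric_mat Ri"
    and "stabilizing (inverse (\<beta>\<^sup>2)) (S_mat Qi Ri K) (A + B ** K) (Bw ** transpose Bw) X"
  shows "X_sol Qi Ri A B Bw \<beta> K = X"
  unfolding X_sol_eq using assms symmetric_S_mat stabilizing_unique by (intro the_equality) blast+

text \<open>Three radii meet: that of the series (entries are bounded by the norm, so the ball lies
  in the box), the distance d up to which f agrees with the series, and that of a ball inside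
  S.\<close>

lemma real_analytic_on_matI:
  fixes f :: "real^'c^'r \<Rightarrow> real"
  assumes "open S"
    and loc: "\<And>K0. K0 \<in> S \<Longrightarrow> \<exists>r>0. \<exists>C g. ana r C g \<and> (\<exists>d>0. \<forall>H\<in>mbox r. norm H < d \<longrightarrow> f (K0 + H) = g H)"
  shows "real_analytic_on_mat f S"
  unfolding real_analytic_on_mat_def
proof
  fix K0 :: "real^'c^'r" assume K0: "K0 \<in> S"
  then obtain r C g d where r: "0 < r" "ana r C g" "0 < d" "\<And>H. H \<in> mbox r \<Longrightarrow> norm H < d \<Longrightarrow> f (K0 + H) = g H"
    using loc by blast
  obtain e where e: "0 < e" "ball K0 e \<subseteq> S" using assms(1) K0 open_contains_ball by blast
  obtain c where c: "\<And>H. H \<in> mbox r \<Longrightarrow> ((\<lambda>\<alpha>. mon H \<alpha> *\<^sub>R c \<alpha>) has_sum g H) UNIV"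
    using r(2) unfolding ana_def by blast
  let ?r = "min (min r d) e"
  show "\<exists>r>0. ball K0 r \<subseteq> S \<and> (\<exists>c. \<forall>K\<in>ball K0 r.
      ((\<lambda>\<alpha>. c \<alpha> * (\<Prod>i\<in>UNIV. \<Prod>j\<in>UNIV. (K $ i $ j - K0 $ i $ j) ^ \<alpha> i j)) has_sum f K) UNIV)"
  proof (intro exI[of _ ?r] exI[of _ c] conjI ballI)
    fix K assume "K \<in> ball K0 ?r"
    then have nH: "norm (K - K0) < ?r" by (simp add: dist_norm norm_minus_commute)
    have "\<bar>(K - K0) $ i $ j\<bar> \<le> r" for i j
      using component_le_norm_cart[of "(K - K0) $ i" j] Finite_Cartesian_Product.norm_nth_le[of "K - K0" i] nH by linarith
    then have H: "K - K0 \<in> mbox r" by (simp add: mbox_def)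
    have "f K = g (K - K0)" using r(4)[OF H] nH by simp
    with c[OF H] show "((\<lambda>\<alpha>. c \<alpha> * (\<Prod>i\<in>UNIV. \<Prod>j\<in>UNIV. (K $ i $ j - K0 $ i $ j) ^ \<alpha> i j)) has_sum f K) UNIV"
      by (simp add: mon_def mult.commute)
  qed (use r e in auto)
qed

theorem theorem2:
  fixes A :: "real^'n^'n" and B :: "real^'m^'n" and Bw :: "real^'n^'n"
    and Q2 :: "real^'n^'n" and R2 :: "real^'m^'m"
    and Qi :: "real^'n^'n" and Ri :: "real^'m^'m" and \<beta> :: real
  assumes "psd Q2" and "pd R2" and "pd Qi" and "pd Ri" and "\<beta> > 0"
    and stabilizable: "\<exists>K :: real^'n^'m. hurwitz (A + B ** K)"
    and detectable: "\<exists>L :: real^'n^'n. hurwitz (A + L ** psd_sqrt Q2)"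
    and beta_gt: "\<beta> > (INF K\<in>{K :: real^'n^'m. hurwitz (A + B ** K)}. hinf_norm Qi Ri A B Bw K)"
  shows "real_analytic_on_mat (J_mix Q2 R2 Qi Ri A B Bw \<beta>) (Kbeta Qi Ri A B Bw \<beta>)"
proof (rule real_analytic_on_matI)
  show "open (Kbeta Qi Ri A B Bw \<beta>)" using \<open>\<beta> > 0\<close> by (rule open_Kbeta)
  fix K0 assume K0: "K0 \<in> Kbeta Qi Ri A B Bw \<beta>"
  have Q: "symmetric_mat Qi" "symmetric_mat Ri" using assms by (auto simp: pd_def)
  let ?stab = "\<lambda>K. stabilizing (inverse (\<beta>\<^sup>2)) (S_mat Qi Ri K) (A + B ** K) (Bw ** transpose Bw)"
  let ?V = "\<lambda>H. Q2 + transpose (K0 + H) ** R2 ** (K0 + H)"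
  obtain v where v: "\<And>r. 0 < r \<Longrightarrow> r \<le> 1 \<Longrightarrow> ana r v ?V"
    using quadratic_ana unfolding uniformly_ana_def by blast
  obtain tr where tr: "0 \<le> tr" "\<And>M :: real^'n^'n. norm (trace M) \<le> tr * norm M"
    using bounded_linear.nonneg_bounded[OF bounded_linear_matrix_trace] by (auto simp: mult.commute)
  have J_ana: "ana r (tr * (v * C)) (\<lambda>H. trace (?V H ** X H))" if "0 < r" "r \<le> 1" "ana r C X" for r C X
    using that v by (intro ana_linear bounded_linear_matrix_trace ana_matrix_mult tr)
  show "\<exists>r>0. \<exists>C g. ana r C g \<and> (\<exists>d>0. \<forall>H\<in>mbox r. norm H < d \<longrightarrow> J_mix Q2 R2 Qi Ri A B Bw \<beta> (K0 + H) = g H)"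
  proof (cases "\<exists>X0. ?stab K0 X0")
    case True
    then obtain X0 where X0: "?stab K0 X0" by blast
    have W: "symmetric_mat (Bw ** transpose Bw)" by (simp add: symmetric_mat_def matrix_transpose_mul)
    obtain r C X where r: "0 < r" "r \<le> 1" "ana r C X" and X: "\<And>H. H \<in> mbox r \<Longrightarrow> ?stab (K0 + H) (X H)"
      by (rule stabilizing_analytic[OF Q W X0]) (rule that)
    have "J_mix Q2 R2 Qi Ri A B Bw \<beta> (K0 + H) = trace (?V H ** X H)" if "H \<in> mbox r" for H
      unfolding J_mix_def X_sol_stabilizing[OF Q X[OF that]] ..
    with r J_ana[OF r] show ?thesis by (intro exI conjI) (auto intro: zero_less_one)
  next
    case False
    \<comment> \<open>Otherwise solvable gains would converge to K0, and closedness would make K0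
      solvable.\<close>
    have "\<exists>d>0. \<forall>K. dist K K0 < d \<longrightarrow> \<not> (\<exists>X. ?stab K X)"
    proof (rule ccontr)
      assume "\<not> ?thesis"
      then have "\<forall>n. \<exists>K X. dist K K0 < inverse (real (Suc n)) \<and> ?stab K X" 
        by (metis inverse_positive_iff_positive of_nat_0_less_iff zero_less_Suc)
      then obtain K X where K: "\<And>n. dist (K n) K0 < inverse (real (Suc n))" and X: "\<And>n. ?stab (K n) (X n)"
        by metis
      have KK: "K \<longlonglongrightarrow> K0"
        using K by (intro metric_tendsto_imp_tendsto[OF LIMSEQ_inverse_real_of_nat]) (auto intro!: always_eventually less_imp_le)
      from stabilizing_closed[OF assms(3-5) K0 KK X] False show False by contradiction
    qed
    then obtain d where d: "0 < d" "\<And>K X. dist K K0 < d \<Longrightarrow> \<not> ?stab K X" by blast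
    \<comment> \<open>For all these gains the predicate under \<open>THE\<close> is the same
      function, false everywhere, so the descriptions denote one fixed matrix, of which nothing more
      is known; the cost is then quadratic in H.\<close>
    define U where "U = (THE X :: real^'n^'n. False)"
    have "X_sol Qi Ri A B Bw \<beta> (K0 + H) = U" if "norm H < d" for H
    proof -
      have "\<not> ?stab (K0 + H) X" for X using that by (intro d(2)) (simp add: dist_norm)
      then have "?stab (K0 + H) = (\<lambda>_. False)" by (simp add: fun_eq_iff)
      then show ?thesis unfolding X_sol_eq U_def by (rule arg_cong)
    qed
    then have "\<forall>H\<in>mbox 1. norm H < d \<longrightarrow> J_mix Q2 R2 Qi Ri A B Bw \<beta> (K0 + H) = trace (?V H ** U)"
      by (simp add: J_mix_def)
    moreover have "ana 1 (tr * (v * norm U)) (\<lambda>H. trace (?V H ** U))"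
      by (intro J_ana ana_const) simp_all
    ultimately show ?thesis using d(1) by (intro exI[of _ 1] exI conjI) auto
  qed
qed

end
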